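(* Let $d\ge2$, $n\ge1$, and let $F=I-H:\mathbb{C}^n\to\mathbb{C}^n$ with $H_i(X)=\sum_{|\alpha|=d}\frac{H_{i,\alpha}}{\alpha!}X^\alpha$ for complex coefficients $H_{i,\alpha}$ ($JH$ may or may not be nilpotent). Let $L:=\max_{i,\alpha}|H_{i,\alpha}|$, and let $g_{i,\alpha}$ be the coefficient of $X^\alpha$ in the $i$-th component of the power series inverse $F^{-1}$. Then for all $i\in[n]$, $k\ge1$ and all $\alpha$ with $|\alpha|=(d-1)k+1$, $$|g_{i,\alpha}|\le\frac{1}{(d!)^k}\frac{1}{(d-1)k+1}\binom{dk}{k}n^{k-1}\frac{|\alpha|!}{\alpha!}L^k. \qquad (1)$$ This bound is sharp: there exists such an $F$ for which equality holds in (1) for all $i$ and $\alpha$. If in addition $(JH)^p=0$ for some $p\in\mathbb{N}$, then for every function $\phi$ in $\mathrm{span}\{\mathbf{1}_{\mathcal{S}}:\mathcal{S}\text{ a length-}p\text{ shuffle class in }\mathcal{C}_k^{(d)}\}$, $$|g_{i,\alpha}|\le\frac{1}{(d!)^k}\frac{1}{(d-1)k+1}\binom{dk}{k}n^{k-1}\frac{|\alpha|!}{\alpha!}L^k\cdot\|\phi-\mathbf{1}\|_1,$$ and in particular there are constants $C,c\in(0,\infty)$ depending only on $d$ and $p$ such that, for all sufficiently large $k$, $$|g_{i,\alpha}|\le\frac{1}{(d!)^k}\frac{1}{(d-1)k+1}\binom{dk}{k}n^{k-1}\frac{|\alpha|!}{\alpha!}L^k\cdot Ce^{-ck}.$$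
   Context: Multi-index notation: $|\alpha|=\sum_j\alpha_j$, $\alpha!=\prod_j\alpha_j!$, $X^\alpha=\prod_jX_j^{\alpha_j}$. $I$ is the identity map and $JH$ the Jacobian matrix of $H$. A $d$-Catalan tree is a rooted planar tree in which each vertex has $0$ or $d$ children; $\mathcal{C}_k^{(d)}$ is the set of those with $k$ internal vertices. For a path $(v_0,\dots,v_p)$ ($v_i$ a child of $v_{i-1}$) in $T\in\mathcal{C}_k^{(d)}$, the shuffle class $\mathrm{Sh}(T;v_0,\dots,v_p)$ is the set of trees obtained from $T$ by rearranging the $(d-1)p$ subtrees subtended by the siblings of $v_1,\dots,v_p$ among those sibling positions; a length-$p$ shuffle class is any such set, $\mathbf{1}_{\mathcal{S}}$ its indicator. $\|f\|_1:=\frac{1}{\#\mathcal{C}_k^{(d)}}\sum_{T\in\mathcal{C}_k^{(d)}}|f(T)|$ and $\mathbf{1}$ is the constant function $1$. *)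

theory Defs
  imports "HOL-Analysis.Analysis" "HOL-Combinatorics.Permutations"
begin

text \<open>Multi-indices are functions nat => nat vanishing from n on; a (formal) power
series in n variables is its coefficient function on such multi-indices.\<close>

definition mi :: "nat \<Rightarrow> (nat \<Rightarrow> nat) set" where
  "mi n = {\<alpha>. \<forall>j\<ge>n. \<alpha> j = 0}"

definition mdeg :: "nat \<Rightarrow> (nat \<Rightarrow> nat) \<Rightarrow> nat" where
  "mdeg n \<alpha> = (\<Sum>j<n. \<alpha> j)"

definition mfact :: "nat \<Rightarrow> (nat \<Rightarrow> nat) \<Rightarrow> nat" where
  "mfact n \<alpha> = (\<Prod>j<n. fact (\<alpha> j))"

definition below :: "nat \<Rightarrow> (nat \<Rightarrow> nat) \<Rightarrow> (nat \<Rightarrow> nat) set" where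
  "below n \<alpha> = {\<beta>. \<forall>j. \<beta> j \<le> \<alpha> j \<and> (n \<le> j \<longrightarrow> \<beta> j = 0)}"

type_synonym fps_n = "(nat \<Rightarrow> nat) \<Rightarrow> complex"

definition smul :: "nat \<Rightarrow> fps_n \<Rightarrow> fps_n \<Rightarrow> fps_n" where
  "smul n f g = (\<lambda>\<alpha>. \<Sum>\<beta>\<in>below n \<alpha>. f \<beta> * g (\<lambda>j. \<alpha> j - \<beta> j))"

definition sone :: fps_n where
  "sone = (\<lambda>\<alpha>. if \<alpha> = (\<lambda>_. 0) then 1 else 0)"

definition spow :: "nat \<Rightarrow> fps_n \<Rightarrow> nat \<Rightarrow> fps_n" where
  "spow n f m = (smul n f ^^ m) sone"

definition smono :: "nat \<Rightarrow> (nat \<Rightarrow> fps_n) \<Rightarrow> (nat \<Rightarrow> nat) \<Rightarrow> fps_n" where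
  "smono n G \<beta> = foldr (\<lambda>j acc. smul n (spow n (G j) (\<beta> j)) acc) [0..<n] sone"

definition unitv :: "nat \<Rightarrow> nat \<Rightarrow> nat" where
  "unitv i = (\<lambda>j. if j = i then 1 else 0)"

definition Hpoly :: "nat \<Rightarrow> nat \<Rightarrow> (nat \<Rightarrow> (nat \<Rightarrow> nat) \<Rightarrow> complex) \<Rightarrow> nat \<Rightarrow> fps_n" where
  "Hpoly n d Hc i = (\<lambda>\<alpha>. if \<alpha> \<in> mi n \<and> mdeg n \<alpha> = d
                          then Hc i \<alpha> / of_nat (mfact n \<alpha>) else 0)"

definition Hcomp :: "nat \<Rightarrow> nat \<Rightarrow> (nat \<Rightarrow> (nat \<Rightarrow> nat) \<Rightarrow> complex) \<Rightarrow> (nat \<Rightarrow> fps_n) \<Rightarrow> nat \<Rightarrow> fps_n" where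
  "Hcomp n d Hc G i = (\<lambda>\<alpha>. \<Sum>\<beta>\<in>{\<beta>\<in>mi n. mdeg n \<beta> = d}.
                          Hc i \<beta> / of_nat (mfact n \<beta>) * smono n G \<beta> \<alpha>)"

text \<open>g is the power series inverse of F = I - H: G(0) = 0 and F(G(X)) = G - H(G) = X.
  (g i alpha = coefficient of X^alpha in the i-th component.)\<close>
definition is_inverse :: "nat \<Rightarrow> nat \<Rightarrow> (nat \<Rightarrow> (nat \<Rightarrow> nat) \<Rightarrow> complex) \<Rightarrow> (nat \<Rightarrow> fps_n) \<Rightarrow> bool" where
  "is_inverse n d Hc g \<longleftrightarrow>
     (\<forall>i<n. g i (\<lambda>_. 0) = 0) \<and>
     (\<forall>i<n. \<forall>\<alpha>\<in>mi n. g i \<alpha> - Hcomp n d Hc g i \<alpha> = (if \<alpha> = unitv i then 1 else 0))"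

definition sderiv :: "nat \<Rightarrow> fps_n \<Rightarrow> fps_n" where
  "sderiv j f = (\<lambda>\<alpha>. of_nat (\<alpha> j + 1) * f (\<alpha>(j := \<alpha> j + 1)))"

definition JH :: "nat \<Rightarrow> nat \<Rightarrow> (nat \<Rightarrow> (nat \<Rightarrow> nat) \<Rightarrow> complex) \<Rightarrow> nat \<Rightarrow> nat \<Rightarrow> fps_n" where
  "JH n d Hc i j = sderiv j (Hpoly n d Hc i)"

definition matmul :: "nat \<Rightarrow> (nat \<Rightarrow> nat \<Rightarrow> fps_n) \<Rightarrow> (nat \<Rightarrow> nat \<Rightarrow> fps_n) \<Rightarrow> nat \<Rightarrow> nat \<Rightarrow> fps_n" where
  "matmul n A B = (\<lambda>i j \<alpha>. \<Sum>l<n. smul n (A i l) (B l j) \<alpha>)"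

definition matid :: "nat \<Rightarrow> nat \<Rightarrow> fps_n" where
  "matid i j = (if i = j then sone else (\<lambda>_. 0))"

definition matpow :: "nat \<Rightarrow> (nat \<Rightarrow> nat \<Rightarrow> fps_n) \<Rightarrow> nat \<Rightarrow> nat \<Rightarrow> nat \<Rightarrow> fps_n" where
  "matpow n A p = (matmul n A ^^ p) matid"

definition JH_nilp :: "nat \<Rightarrow> nat \<Rightarrow> (nat \<Rightarrow> (nat \<Rightarrow> nat) \<Rightarrow> complex) \<Rightarrow> nat \<Rightarrow> bool" where
  "JH_nilp n d Hc p \<longleftrightarrow> (\<forall>i<n. \<forall>j<n. \<forall>\<alpha>\<in>mi n. matpow n (JH n d Hc) p i j \<alpha> = 0)"

definition Lmax :: "nat \<Rightarrow> nat \<Rightarrow> (nat \<Rightarrow> (nat \<Rightarrow> nat) \<Rightarrow> complex) \<Rightarrow> real" where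
  "Lmax n d Hc = Max {cmod (Hc i \<beta>) | i \<beta>. i < n \<and> \<beta> \<in> mi n \<and> mdeg n \<beta> = d}"

definition gbound :: "nat \<Rightarrow> nat \<Rightarrow> nat \<Rightarrow> (nat \<Rightarrow> nat) \<Rightarrow> real \<Rightarrow> real" where
  "gbound d n k \<alpha> L =
     1 / (fact d) ^ k * (1 / real ((d - 1) * k + 1)) * real ((d * k) choose k)
     * real n ^ (k - 1) * (fact (mdeg n \<alpha>) / real (mfact n \<alpha>)) * L ^ k"

datatype ptree = Nd "ptree list"

fun internal :: "ptree \<Rightarrow> nat" where
  "internal (Nd ts) = (if ts = [] then 0 else 1 + sum_list (map internal ts))"

fun dcat :: "nat \<Rightarrow> ptree \<Rightarrow> bool" where
  "dcat d (Nd ts) = (ts = [] \<or> (length ts = d \<and> list_all (dcat d) ts))"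

definition catalan :: "nat \<Rightarrow> nat \<Rightarrow> ptree set" where
  "catalan d k = {T. dcat d T \<and> internal T = k}"

text \<open>Vertices are addressed by positions (list of child indices from the root).\<close>
fun ispos :: "ptree \<Rightarrow> nat list \<Rightarrow> bool" where
  "ispos T [] = True"
| "ispos (Nd ts) (c # cs) = (c < length ts \<and> ispos (ts ! c) cs)"

fun subt :: "ptree \<Rightarrow> nat list \<Rightarrow> ptree" where
  "subt T [] = T"
| "subt (Nd ts) (c # cs) = (if c < length ts then subt (ts ! c) cs else Nd [])"

fun repl :: "ptree \<Rightarrow> nat list \<Rightarrow> ptree \<Rightarrow> ptree" where
  "repl T [] S = S"
| "repl (Nd ts) (c # cs) S = (if c < length ts then Nd (ts[c := repl (ts ! c) cs S]) else Nd ts)"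

definition is_internal :: "ptree \<Rightarrow> nat list \<Rightarrow> bool" where
  "is_internal T v \<longleftrightarrow> ispos T v \<and> subt T v \<noteq> Nd []"

text \<open>A path (v_0,...,v_p) with v_i = v_0 @ take i cs, v_i a child of v_{i-1}.\<close>
definition is_path :: "ptree \<Rightarrow> nat list \<Rightarrow> nat list \<Rightarrow> bool" where
  "is_path T v0 cs \<longleftrightarrow> ispos T v0 \<and>
     (\<forall>i<length cs. is_internal T (v0 @ take i cs) \<and>
                    cs ! i < length (case subt T (v0 @ take i cs) of Nd ts \<Rightarrow> ts))"

definition sibpos :: "nat \<Rightarrow> nat list \<Rightarrow> nat list \<Rightarrow> nat list list" where
  "sibpos d v0 cs = concat (map (\<lambda>i. map (\<lambda>j. v0 @ take i cs @ [j])
                                         (filter (\<lambda>j. j \<noteq> cs ! i) [0..<d]))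
                                [0..<length cs])"

definition repl_all :: "ptree \<Rightarrow> (nat list \<times> ptree) list \<Rightarrow> ptree" where
  "repl_all T rs = foldl (\<lambda>T' (q, S). repl T' q S) T rs"

definition shuffle_class :: "nat \<Rightarrow> ptree \<Rightarrow> nat list \<Rightarrow> nat list \<Rightarrow> ptree set" where
  "shuffle_class d T v0 cs =
     (let P = sibpos d v0 cs; N = length P in
      {repl_all T (map (\<lambda>m. (P ! m, subt T (P ! (\<sigma> m)))) [0..<N]) | \<sigma>. \<sigma> permutes {..<N}})"

definition shuffle_classes :: "nat \<Rightarrow> nat \<Rightarrow> nat \<Rightarrow> ptree set set" where
  "shuffle_classes d k p =
     {shuffle_class d T v0 cs | T v0 cs. T \<in> catalan d k \<and> is_path T v0 cs \<and> length cs = p}"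

definition shuffle_span :: "nat \<Rightarrow> nat \<Rightarrow> nat \<Rightarrow> (ptree \<Rightarrow> real) set" where
  "shuffle_span d k p =
     {\<phi>. \<exists>A c. finite A \<and> A \<subseteq> shuffle_classes d k p \<and>
            \<phi> = (\<lambda>T. \<Sum>S\<in>A. c S * indicator S T)}"

definition norm1 :: "nat \<Rightarrow> nat \<Rightarrow> (ptree \<Rightarrow> real) \<Rightarrow> real" where
  "norm1 d k f = (\<Sum>T\<in>catalan d k. \<bar>f T\<bar>) / real (card (catalan d k))"

end

theory Submission
  imports Defs "HOL-Combinatorics.Multiset_Permutations"
begin

text \<open>
  The Picard iterates of \<open>G = X + H(G)\<close> are the sums of the weights of the \<open>d\<close>-ary trees of
  bounded height, where the weight of a tree is the composition of the form \<open>H\<close> that it describes.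
  Hence the degree \<open>(d-1)k+1\<close> part of the inverse is the sum of the weights of the \<open>d\<close>-Catalan trees
  with \<open>k\<close> internal vertices.  The weight of every tree is majorised by the weight for the constant
  coefficients \<open>L\<close>, which is \<open>n\<^bsup>k-1\<^esup> (L/d!)\<^sup>k (X\<^sub>1 + \<cdots> + X\<^sub>n)\<^bsup>(d-1)k+1\<^esup>\<close>; this gives the bound
  and its sharpness.

  Polarising \<open>(JH)\<^sup>p = 0\<close> shows that the weights of the trees in a length-\<open>p\<close> shuffle class sum to
  zero, so \<open>\<phi>\<close> can be subtracted for free.  If a tree contains the left comb with \<open>p\<close> internal
  vertices as a fringe subtree then all shuffled subtrees are leaves and its shuffle class is a
  singleton; only the trees avoiding this comb survive.  Their generating function satisfies
  \<open>A = 1 + x A\<^sup>d - x\<^sup>p\<close>, hence it converges slightly beyond the radius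
  \<open>\<rho> = (d-1)\<^bsup>d-1\<^esup>/d\<^sup>d\<close> of the Catalan series, while the number of all trees is at least
  \<open>\<rho>\<^bsup>-k\<^esup>\<close> up to a polynomial factor.
\<close>

section \<open>Tuples and rearrangements of lists\<close>

definition tuples :: "'a set \<Rightarrow> nat \<Rightarrow> 'a list set" where
  "tuples A r = {xs. set xs \<subseteq> A \<and> length xs = r}"

lemma tuples_0 [simp]: "tuples A 0 = {[]}"
  by (auto simp: tuples_def)

lemma finite_tuples [simp]: "finite A \<Longrightarrow> finite (tuples A r)"
  by (simp add: tuples_def finite_lists_length_eq)

lemma sum_tuples_Suc: "(\<Sum>xs\<in>tuples A (Suc r). f xs) = (\<Sum>x\<in>A. \<Sum>xs\<in>tuples A r. f (x # xs))"
proof -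
  have "tuples A (Suc r) = (\<lambda>(x, xs). x # xs) ` (A \<times> tuples A r)"
    by (auto simp: tuples_def length_Suc_conv image_iff)
  then have "(\<Sum>xs\<in>tuples A (Suc r). f xs) = (\<Sum>(x, xs)\<in>A \<times> tuples A r. f (x # xs))"
    by (simp add: sum.reindex inj_on_def case_prod_beta)
  then show ?thesis by (simp add: sum.cartesian_product)
qed

lemma sum_tuples_append:
  "(\<Sum>xs\<in>tuples A (r + s). f xs) = (\<Sum>xs\<in>tuples A r. \<Sum>ys\<in>tuples A s. f (xs @ ys))"
  by (induction r arbitrary: f) (simp_all add: sum_tuples_Suc)

lemma prod_list_sum_conv_tuples:
  fixes f :: "'a \<Rightarrow> 'b \<Rightarrow> 'c :: comm_semiring_1"
  shows "(\<Prod>x\<leftarrow>xs. \<Sum>y\<in>B. f x y) = (\<Sum>ys\<in>tuples B (length xs). \<Prod>(x, y)\<leftarrow>zip xs ys. f x y)"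
  by (induction xs) (simp_all add: sum_tuples_Suc sum_product)

lemma power_sum_conv_tuples:
  fixes f :: "'b \<Rightarrow> 'c :: comm_semiring_1"
  shows "(\<Sum>y\<in>B. f y) ^ r = (\<Sum>ys\<in>tuples B r. \<Prod>y\<leftarrow>ys. f y)"
  by (induction r) (simp_all add: sum_tuples_Suc sum_product)

definition insert_at :: "nat \<Rightarrow> 'a \<Rightarrow> 'a list \<Rightarrow> 'a list" where
  "insert_at c y xs = take c xs @ y # drop c xs"

lemma length_insert_at [simp]: "length (insert_at c y xs) = Suc (length xs)"
  by (simp add: insert_at_def)

lemma mset_insert_at [simp]: "mset (insert_at c y xs) = add_mset y (mset xs)"
proof -
  have "mset xs = mset (take c xs) + mset (drop c xs)" by (metis append_take_drop_id mset_append)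
  then show ?thesis by (simp add: insert_at_def)
qed

lemma set_insert_at [simp]: "set (insert_at c y xs) = insert y (set xs)"
  by (metis mset_insert_at set_mset_add_mset_insert set_mset_mset)

lemma insert_at_not_Nil [simp]: "insert_at c y xs \<noteq> []"
  by (simp add: insert_at_def)

lemma nth_insert_at [simp]: "c \<le> length xs \<Longrightarrow> insert_at c y xs ! c = y"
  by (simp add: insert_at_def nth_append)

lemma insert_at_update [simp]: "c \<le> length xs \<Longrightarrow> (insert_at c y xs)[c := z] = insert_at c z xs"
  by (simp add: insert_at_def list_update_append)

lemma list_update_conv_insert_at:
  "c < length xs \<Longrightarrow> xs[c := y] = insert_at c y (take c xs @ drop (Suc c) xs)"
  by (simp add: insert_at_def upd_conv_take_nth_drop)

lemma insert_at_inject: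
  assumes "c \<le> length xs" "length xs = length ys" "insert_at c x xs = insert_at c y ys"
  shows "x = y \<and> xs = ys"
proof -
  have "take c xs = take c ys" "x = y" "drop c xs = drop c ys"
    using assms by (auto simp: insert_at_def)
  then show ?thesis by (metis append_take_drop_id)
qed

lemma sum_list_map_insert_at:
  fixes f :: "'a \<Rightarrow> 'b :: comm_monoid_add"
  shows "(\<Sum>x\<leftarrow>insert_at c y xs. f x) = f y + (\<Sum>x\<leftarrow>xs. f x)"
  by (simp flip: sum_mset_sum_list)

lemma prod_list_map_insert_at:
  fixes f :: "'a \<Rightarrow> 'b :: comm_monoid_mult"
  shows "(\<Prod>x\<leftarrow>insert_at c y xs. f x) = f y * (\<Prod>x\<leftarrow>xs. f x)"
  by (simp flip: prod_mset_prod_list)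

lemma zip_insert_at:
  "length xs = length ys \<Longrightarrow>
    zip (insert_at c x xs) (insert_at c y ys) = insert_at c (x, y) (zip xs ys)"
  by (simp add: insert_at_def take_zip drop_zip)

lemma sum_tuples_insert_at:
  assumes "c \<le> r"
  shows "(\<Sum>xs\<in>tuples A (Suc r). f xs) = (\<Sum>x\<in>A. \<Sum>xs\<in>tuples A r. f (insert_at c x xs))"
proof -
  obtain s where r: "r = c + s" using assms le_Suc_ex by blast
  have "(\<Sum>xs\<in>tuples A (c + Suc s). f xs) = (\<Sum>xs\<in>tuples A c. \<Sum>x\<in>A. \<Sum>ys\<in>tuples A s. f (xs @ x # ys))"
    by (simp only: sum_tuples_append sum_tuples_Suc)
  also have "\<dots> = (\<Sum>x\<in>A. \<Sum>xs\<in>tuples A c. \<Sum>ys\<in>tuples A s. f (insert_at c x (xs @ ys)))"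
    by (subst sum.swap) (auto simp: insert_at_def tuples_def intro!: sum.cong)
  finally show ?thesis by (simp add: r sum_tuples_append)
qed

definition msets :: "'a set \<Rightarrow> nat \<Rightarrow> 'a multiset set" where
  "msets V r = {A. set_mset A \<subseteq> V \<and> size A = r}"

lemma mset_tuples: "mset ` tuples V r = msets V r"
proof (intro equalityI subsetI)
  fix A assume "A \<in> msets V r"
  moreover obtain xs where "mset xs = A" using ex_mset by blast
  ultimately show "A \<in> mset ` tuples V r" by (auto simp: msets_def tuples_def)
qed (auto simp: msets_def tuples_def)

lemma finite_msets [simp]: "finite V \<Longrightarrow> finite (msets V r)"
  by (simp flip: mset_tuples)

abbreviation multinomial :: "'a multiset \<Rightarrow> nat" where
  "multinomial A \<equiv> card (permutations_of_multiset A)"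

lemma permutations_conv_tuples:
  "A \<in> msets V r \<Longrightarrow> {xs \<in> tuples V r. mset xs = A} = permutations_of_multiset A"
  by (auto simp: msets_def tuples_def permutations_of_multiset_def)

lemma sum_tuples_conv_permutations:
  assumes "finite V"
  shows "(\<Sum>xs\<in>tuples V r. f xs) = (\<Sum>A\<in>msets V r. \<Sum>xs\<in>permutations_of_multiset A. f xs)"
proof -
  have "(\<Sum>xs\<in>tuples V r. f xs) = (\<Sum>A\<in>msets V r. sum f {xs \<in> tuples V r. mset xs = A})"
    unfolding mset_tuples[symmetric] using assms by (intro sum.image_gen) simp
  then show ?thesis by (simp add: permutations_conv_tuples)
qed

lemma sum_tuples_mset:
  fixes f :: "'v multiset \<Rightarrow> 'a :: semiring_1"
  assumes "finite V"
  shows "(\<Sum>xs\<in>tuples V r. f (mset xs))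
    = (\<Sum>A\<in>msets V r. of_nat (multinomial A) * f A)"
  unfolding sum_tuples_conv_permutations[OF assms]
  by (intro sum.cong) (simp_all add: permutations_of_multisetD)

lemma bij_betw_permute_list:
  assumes \<pi>: "\<pi> permutes {..<size M}"
  shows "bij_betw (permute_list \<pi>) (permutations_of_multiset M) (permutations_of_multiset M)"
proof -
  let ?P = "permutations_of_multiset M"
  have perm: "\<pi> permutes {..<length xs}" "inv \<pi> permutes {..<length xs}" if "xs \<in> ?P" for xs
    using \<pi> permutes_inv[OF \<pi>] that by (auto simp: permutations_of_multiset_def)
  have "permute_list (inv \<pi>) (permute_list \<pi> xs) = xs" if "xs \<in> ?P" for xs
    using permute_list_compose[OF perm(2)[OF that], of \<pi>] permutes_inv_o(1)[OF \<pi>] by simp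
  then have "inj_on (permute_list \<pi>) ?P" by (rule inj_on_inverseI)
  moreover have "permute_list \<pi> ` ?P \<subseteq> ?P"
    using perm(1) by (auto simp: permutations_of_multiset_def)
  ultimately show ?thesis by (simp add: bij_betw_def endo_inj_surj)
qed

lemma sum_permutations_prod_zip_cong:
  fixes f :: "'a \<Rightarrow> 'b \<Rightarrow> 'c :: comm_semiring_1"
  assumes "mset js = mset js'" "length js = size M"
  shows "(\<Sum>xs\<in>permutations_of_multiset M. \<Prod>(j, x)\<leftarrow>zip js xs. f j x)
    = (\<Sum>xs\<in>permutations_of_multiset M. \<Prod>(j, x)\<leftarrow>zip js' xs. f j x)"
proof -
  let ?P = "permutations_of_multiset M"
  obtain \<pi> where \<pi>: "\<pi> permutes {..<length js'}" "permute_list \<pi> js' = js"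
    using mset_eq_permutation[OF assms(1)] .
  have len: "length js' = size M" using assms by (metis size_mset)
  have "(\<Sum>xs\<in>?P. \<Prod>(j, x)\<leftarrow>zip js xs. f j x) = (\<Sum>xs\<in>?P. \<Prod>(j, x)\<leftarrow>zip js (permute_list \<pi> xs). f j x)"
    using \<pi>(1) len by (intro sum.reindex_bij_betw[symmetric] bij_betw_permute_list) simp
  also have "\<dots> = (\<Sum>xs\<in>?P. \<Prod>(j, x)\<leftarrow>zip js' xs. f j x)"
  proof (rule sum.cong)
    fix xs assume "xs \<in> ?P"
    then have "length js' = length xs" using len by (auto simp: permutations_of_multiset_def)
    then have "zip js (permute_list \<pi> xs) = permute_list \<pi> (zip js' xs)"
      using permute_list_zip[OF \<pi>(1) refl \<open>length js' = length xs\<close>] \<pi>(2) by simp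
    then have "mset (zip js (permute_list \<pi> xs)) = mset (zip js' xs)"
      using \<pi>(1) \<open>length js' = length xs\<close> by simp
    then show "(\<Prod>(j, x)\<leftarrow>zip js (permute_list \<pi> xs). f j x) = (\<Prod>(j, x)\<leftarrow>zip js' xs. f j x)"
      by (metis mset_map prod_mset_prod_list)
  qed simp
  finally show ?thesis .
qed

section \<open>Power series indexed by multisets of variables\<close>

lemma finite_subseteq_mset [simp]: "finite {B. B \<subseteq># A}"
proof (rule finite_subset)
  show "{B. B \<subseteq># A} \<subseteq> (\<Union>r\<le>size A. msets (set_mset A) r)"
    by (auto simp: msets_def size_mset_mono dest: mset_subset_eqD)
qed simp

lemma diff_diff_cancel_mset: "B \<subseteq># A \<Longrightarrow> A - (A - B) = B"
  by (auto simp: multiset_eq_iff subseteq_mset_def)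

lemma sum_splits_commute:
  fixes f g :: "'v multiset \<Rightarrow> 'a :: comm_semiring_0"
  shows "(\<Sum>B | B \<subseteq># A. f B * g (A - B)) = (\<Sum>B | B \<subseteq># A. g B * f (A - B))"
  by (rule sum.reindex_bij_witness[where i = "\<lambda>B. A - B" and j = "\<lambda>B. A - B"])
    (auto simp: diff_diff_cancel_mset mult.commute)

lemma sum_splits_assoc:
  fixes f g h :: "'v multiset \<Rightarrow> 'a :: semiring_0"
  shows "(\<Sum>B | B \<subseteq># A. (\<Sum>C | C \<subseteq># B. f C * g (B - C)) * h (A - B))
    = (\<Sum>C | C \<subseteq># A. f C * (\<Sum>D | D \<subseteq># A - C. g D * h (A - C - D)))"
proof -
  have "(\<Sum>B | B \<subseteq># A. (\<Sum>C | C \<subseteq># B. f C * g (B - C)) * h (A - B))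
    = (\<Sum>(B, C)\<in>(SIGMA B:{B. B \<subseteq># A}. {C. C \<subseteq># B}). f C * g (B - C) * h (A - B))"
    by (simp add: sum_distrib_right sum.Sigma)
  also have "\<dots> = (\<Sum>(C, D)\<in>(SIGMA C:{C. C \<subseteq># A}. {D. D \<subseteq># A - C}). f C * (g D * h (A - C - D)))"
    by (rule sum.reindex_bij_witness[where i = "\<lambda>(C, D). (C + D, C)" and j = "\<lambda>(B, C). (C, B - C)"])
      (auto simp: subset_mset.le_diff_conv2 add.commute mult.assoc diff_diff_add_mset
        intro: subset_mset.order_trans)
  also have "\<dots> = (\<Sum>C | C \<subseteq># A. f C * (\<Sum>D | D \<subseteq># A - C. g D * h (A - C - D)))"
    by (simp add: sum_distrib_left sum.Sigma)
  finally show ?thesis .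
qed

typedef ('v, 'a) mps = "UNIV :: ('v multiset \<Rightarrow> 'a) set"
  morphisms mcoeff Mps ..

setup_lifting type_definition_mps

lemma mps_eqI: "(\<And>A. mcoeff f A = mcoeff g A) \<Longrightarrow> f = g"
  by (metis ext mcoeff_inject)

instantiation mps :: (type, comm_ring_1) comm_ring_1
begin

lift_definition zero_mps :: "('a, 'b) mps" is "\<lambda>_. 0" .
lift_definition one_mps :: "('a, 'b) mps" is "\<lambda>A. if A = {#} then 1 else 0" .
lift_definition plus_mps :: "('a, 'b) mps \<Rightarrow> ('a, 'b) mps \<Rightarrow> ('a, 'b) mps" is "\<lambda>f g A. f A + g A" .
lift_definition minus_mps :: "('a, 'b) mps \<Rightarrow> ('a, 'b) mps \<Rightarrow> ('a, 'b) mps" is "\<lambda>f g A. f A - g A" .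
lift_definition uminus_mps :: "('a, 'b) mps \<Rightarrow> ('a, 'b) mps" is "\<lambda>f A. - f A" .
lift_definition times_mps :: "('a, 'b) mps \<Rightarrow> ('a, 'b) mps \<Rightarrow> ('a, 'b) mps" is
  "\<lambda>f g A. \<Sum>B | B \<subseteq># A. f B * g (A - B)" .

instance
proof
  fix a b c :: "('a, 'b) mps"
  show "a * b * c = a * (b * c)" by transfer (rule ext, rule sum_splits_assoc)
  show "a * b = b * a" by transfer (rule ext, rule sum_splits_commute)
  show "1 * a = a"
  proof (transfer, rule ext)
    fix a :: "'a multiset \<Rightarrow> 'b" and A
    have "(\<Sum>B | B \<subseteq># A. (if B = {#} then 1 else 0) * a (A - B))
      = (\<Sum>B\<in>{{#}}. (if B = {#} then 1 else 0) * a (A - B))"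
      by (rule sum.mono_neutral_right) auto
    then show "(\<Sum>B | B \<subseteq># A. (if B = {#} then 1 else 0) * a (A - B)) = a A" by simp
  qed
  show "(a + b) * c = a * c + b * c" by transfer (auto simp: algebra_simps sum.distrib)
  show "(0 :: ('a, 'b) mps) \<noteq> 1" by transfer (metis zero_neq_one)
qed (transfer; auto simp: algebra_simps)+

end

lemma mcoeff_0 [simp]: "mcoeff 0 A = 0"
  and mcoeff_1: "mcoeff 1 A = (if A = {#} then 1 else 0)"
  and mcoeff_add [simp]: "mcoeff (f + g) A = mcoeff f A + mcoeff g A"
  and mcoeff_diff [simp]: "mcoeff (f - g) A = mcoeff f A - mcoeff g A"
  and mcoeff_mult: "mcoeff (f * g) A = (\<Sum>B | B \<subseteq># A. mcoeff f B * mcoeff g (A - B))"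
  by (transfer; simp)+

lemma mcoeff_sum [simp]: "mcoeff (sum f I) A = (\<Sum>i\<in>I. mcoeff (f i) A)"
  by (induction I rule: infinite_finite_induct) auto

lift_definition mps_const :: "'a :: comm_ring_1 \<Rightarrow> ('v, 'a) mps" is
  "\<lambda>c A. if A = {#} then c else 0" .

lift_definition mps_X :: "'v \<Rightarrow> ('v, 'a :: comm_ring_1) mps" is
  "\<lambda>i A. if A = {#i#} then 1 else 0" .

lemma mcoeff_const: "mcoeff (mps_const c) A = (if A = {#} then c else 0)"
  and mcoeff_X: "mcoeff (mps_X i) A = (if A = {#i#} then 1 else 0)"
  by (transfer; simp)+

lemma mcoeff_const_mult [simp]: "mcoeff (mps_const c * f) A = c * mcoeff f A"
proof -
  have "mcoeff (mps_const c * f) A = (\<Sum>B\<in>{{#}}. mcoeff (mps_const c) B * mcoeff f (A - B))"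
    unfolding mcoeff_mult by (rule sum.mono_neutral_right) (auto simp: mcoeff_const)
  then show ?thesis by (simp add: mcoeff_const)
qed

lemma mps_const_0 [simp]: "mps_const 0 = 0"
  and mps_const_1 [simp]: "mps_const 1 = 1"
  and mps_const_add: "mps_const (a + b) = mps_const a + mps_const b"
  by (transfer; auto)+

lemma mps_const_mult: "mps_const (a * b) = mps_const a * mps_const b"
  by (rule mps_eqI) (simp add: mcoeff_const)

lemma mps_const_sum: "mps_const (sum f I) = (\<Sum>i\<in>I. mps_const (f i))"
  by (induction I rule: infinite_finite_induct) (auto simp: mps_const_add)

lemma mps_const_of_nat: "mps_const (of_nat k) = of_nat k"
  by (induction k) (auto simp: mps_const_add)

lemma mcoeff_X_mult: "mcoeff (mps_X i * f) A = (if i \<in># A then mcoeff f (A - {#i#}) else 0)"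
proof -
  have "mcoeff (mps_X i * f) A
    = (\<Sum>B\<in>{B. B \<subseteq># A} \<inter> {{#i#}}. mcoeff (mps_X i) B * mcoeff f (A - B))"
    unfolding mcoeff_mult by (rule sum.mono_neutral_right) (auto simp: mcoeff_X)
  also have "{B. B \<subseteq># A} \<inter> {{#i#}} = (if i \<in># A then {{#i#}} else {})" by auto
  finally show ?thesis by (simp add: mcoeff_X)
qed

lemma mcoeff_prod_list_X: "mcoeff (\<Prod>j\<leftarrow>js. mps_X j) A = (if mset js = A then 1 else 0)"
  by (induction js arbitrary: A) (auto simp: mcoeff_1 mcoeff_X_mult dest: insert_DiffM)

lemma mcoeff_sum_tuples_X:
  assumes "finite V"
  shows "mcoeff (\<Sum>js\<in>tuples V r. mps_const (\<kappa> js) * (\<Prod>j\<leftarrow>js. mps_X j)) A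
    = (\<Sum>js | js \<in> tuples V r \<and> mset js = A. \<kappa> js)"
proof -
  have "mcoeff (\<Sum>js\<in>tuples V r. mps_const (\<kappa> js) * (\<Prod>j\<leftarrow>js. mps_X j)) A
    = (\<Sum>js\<in>tuples V r. if mset js = A then \<kappa> js else 0)"
    by (simp add: mcoeff_prod_list_X if_distrib[of "(*) _"] cong: if_cong)
  then show ?thesis using assms by (simp flip: sum.inter_filter)
qed

lemma mcoeff_symmetric_sum_tuples_X:
  assumes "finite V"
  shows "mcoeff (\<Sum>js\<in>tuples V r. mps_const (\<kappa> (mset js)) * (\<Prod>j\<leftarrow>js. mps_X j)) A
    = (if A \<in> msets V r then of_nat (multinomial A) * \<kappa> A else 0)"
proof -
  have card: "card {js \<in> tuples V r. mset js = A}
    = (if A \<in> msets V r then multinomial A else 0)"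
    by (auto simp: permutations_conv_tuples card_eq_0_iff simp flip: mset_tuples)
  have "mcoeff (\<Sum>js\<in>tuples V r. mps_const (\<kappa> (mset js)) * (\<Prod>j\<leftarrow>js. mps_X j)) A
    = of_nat (card {js \<in> tuples V r. mset js = A}) * \<kappa> A"
    by (subst mcoeff_sum_tuples_X[OF assms]) simp
  then show ?thesis unfolding card by simp
qed

lemma mcoeff_sum_X_power:
  fixes V :: "'v set"
  assumes "finite V"
  shows "mcoeff ((\<Sum>j\<in>V. mps_X j :: ('v, 'a :: comm_ring_1) mps) ^ r) A
    = (if A \<in> msets V r then of_nat (multinomial A) else 0)"
proof -
  have "(\<Sum>j\<in>V. mps_X j :: ('v, 'a) mps) ^ r = (\<Sum>js\<in>tuples V r. mps_const 1 * (\<Prod>j\<leftarrow>js. mps_X j))"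
    by (simp add: power_sum_conv_tuples)
  then show ?thesis
    by (simp only: mcoeff_symmetric_sum_tuples_X[OF assms, where \<kappa> = "\<lambda>_. 1"] mult_1_right)
qed

definition order_ge :: "nat \<Rightarrow> ('v, 'a :: comm_ring_1) mps \<Rightarrow> bool" where
  "order_ge m f \<longleftrightarrow> (\<forall>A. size A < m \<longrightarrow> mcoeff f A = 0)"

lemma order_ge_zero [simp]: "order_ge m 0"
  and order_ge_X: "order_ge 1 (mps_X i)"
  and order_ge_add: "order_ge m f \<Longrightarrow> order_ge m g \<Longrightarrow> order_ge m (f + g)"
  and order_ge_diff: "order_ge m f \<Longrightarrow> order_ge m g \<Longrightarrow> order_ge m (f - g)"
  and order_ge_const_mult: "order_ge m f \<Longrightarrow> order_ge m (mps_const c * f)"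
  and order_ge_mono: "order_ge m f \<Longrightarrow> m' \<le> m \<Longrightarrow> order_ge m' f"
  by (auto simp: order_ge_def mcoeff_X)

lemma order_ge_0 [simp]: "order_ge 0 f"
  by (simp add: order_ge_def)

lemma order_ge_sum: "(\<And>i. i \<in> I \<Longrightarrow> order_ge m (f i)) \<Longrightarrow> order_ge m (sum f I)"
  by (auto simp: order_ge_def)

lemma order_ge_mult:
  assumes "order_ge l f" "order_ge m g"
  shows "order_ge (l + m) (f * g)"
  unfolding order_ge_def mcoeff_mult
proof (intro allI impI sum.neutral ballI)
  fix A B :: "'a multiset"
  assume "size A < l + m" "B \<in> {B. B \<subseteq># A}"
  then have "size B < l \<or> size (A - B) < m"
    using size_mset_mono[of B A] by (simp add: size_Diff_submset) linarith
  then show "mcoeff f B * mcoeff g (A - B) = 0" using assms by (auto simp: order_ge_def)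
qed

lemma order_ge_prod_list:
  "(\<And>f. f \<in> set fs \<Longrightarrow> order_ge 1 f) \<Longrightarrow> order_ge (length fs) (prod_list fs)"
proof (induction fs)
  case (Cons f fs)
  then show ?case using order_ge_mult[of 1 f "length fs" "prod_list fs"] by simp
qed simp

lemma mps_eqI_order: "(\<And>m. order_ge m (f - g)) \<Longrightarrow> f = g"
  by (rule mps_eqI) (metis eq_iff_diff_eq_0 lessI mcoeff_diff order_ge_def)

definition homogeneous :: "'v set \<Rightarrow> nat \<Rightarrow> ('v, 'a :: comm_ring_1) mps \<Rightarrow> bool" where
  "homogeneous V r f \<longleftrightarrow> (\<forall>A. mcoeff f A \<noteq> 0 \<longrightarrow> A \<in> msets V r)"

lemma homogeneous_1: "homogeneous V 0 1"
  and homogeneous_X: "i \<in> V \<Longrightarrow> homogeneous V 1 (mps_X i)"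
  by (auto simp: homogeneous_def mcoeff_1 mcoeff_X msets_def)

lemma homogeneous_const_mult: "homogeneous V r f \<Longrightarrow> homogeneous V r (mps_const c * f)"
  unfolding homogeneous_def mcoeff_const_mult by (metis mult_zero_right)

lemma homogeneous_sum: "(\<And>i. i \<in> I \<Longrightarrow> homogeneous V r (f i)) \<Longrightarrow> homogeneous V r (sum f I)"
  unfolding homogeneous_def mcoeff_sum by (metis sum.neutral)

lemma homogeneous_mult:
  assumes "homogeneous V r f" "homogeneous V s g"
  shows "homogeneous V (r + s) (f * g)"
  unfolding homogeneous_def
proof (intro allI impI)
  fix A assume "mcoeff (f * g) A \<noteq> 0"
  then obtain B where B: "B \<subseteq># A" "mcoeff f B * mcoeff g (A - B) \<noteq> 0"
    unfolding mcoeff_mult by (metis (mono_tags, lifting) mem_Collect_eq sum.neutral)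
  then have "mcoeff f B \<noteq> 0" "mcoeff g (A - B) \<noteq> 0" by auto
  then have "B \<in> msets V r" "A - B \<in> msets V s"
    using assms unfolding homogeneous_def by blast+
  then have "B + (A - B) \<in> msets V (r + s)" by (auto simp: msets_def)
  then show "A \<in> msets V (r + s)" using B(1) by simp
qed

section \<open>Counting Catalan trees\<close>

lemma dcat_NdD: "dcat d (Nd us) \<Longrightarrow> us \<noteq> [] \<Longrightarrow> length us = d \<and> (\<forall>u\<in>set us. dcat d u)"
  by (auto simp: list_all_iff)

lemma internal_eq_0_iff [simp]: "internal T = 0 \<longleftrightarrow> T = Nd []"
  by (cases T) auto

lemma internal_child_less: "u \<in> set us \<Longrightarrow> internal u < internal (Nd us)"
  using member_le_sum_list[of "internal u" "map internal us"] by auto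

abbreviation leaves :: "nat \<Rightarrow> ptree list" where
  "leaves m \<equiv> replicate m (Nd [])"

primrec trees :: "nat \<Rightarrow> nat \<Rightarrow> ptree set" where
  "trees d 0 = {}"
| "trees d (Suc h) = insert (Nd []) (Nd ` tuples (trees d h) d)"

lemma finite_trees [simp]: "finite (trees d h)"
  by (induction h) simp_all

lemma dcat_trees: "T \<in> trees d h \<Longrightarrow> dcat d T"
  by (induction h arbitrary: T) (auto simp: tuples_def list_all_iff subset_iff)

lemma dcat_imp_mem_trees: "dcat d T \<Longrightarrow> internal T < h \<Longrightarrow> T \<in> trees d h"
proof (induction h arbitrary: T)
  case (Suc h)
  obtain us where T: "T = Nd us" by (cases T)
  show ?case
  proof (cases "us = []")
    case False
    then have us: "length us = d" "\<forall>u\<in>set us. dcat d u"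
      using Suc.prems(1) unfolding T by (blast dest: dcat_NdD)+
    have "internal u < h" if "u \<in> set us" for u
      using internal_child_less[OF that] Suc.prems(2) unfolding T by linarith
    then have "us \<in> tuples (trees d h) d" using Suc.IH us by (auto simp: tuples_def)
    then show ?thesis by (simp add: T)
  qed (simp add: T)
qed simp

lemma trees_Suc_subset: "trees d h \<subseteq> trees d (Suc h)"
  by (induction h) (auto simp: tuples_def)

lemma trees_mono: "h \<le> h' \<Longrightarrow> trees d h \<subseteq> trees d h'"
  using trees_Suc_subset by (rule lift_Suc_mono_le)

lemma catalan_subset_trees: "catalan d k \<subseteq> trees d (Suc k)"
  by (auto simp: catalan_def dcat_imp_mem_trees simp del: trees.simps)

lemma finite_catalan [simp]: "finite (catalan d k)"
  using catalan_subset_trees finite_trees by (rule finite_subset)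

definition forests :: "nat \<Rightarrow> nat \<Rightarrow> nat \<Rightarrow> ptree list set" where
  "forests d r k = {ts. length ts = r \<and> (\<forall>t\<in>set ts. dcat d t) \<and> sum_list (map internal ts) = k}"

lemma finite_forests [simp]: "finite (forests d r k)"
proof (rule finite_subset)
  have "T \<in> trees d (Suc k)" if "ts \<in> forests d r k" "T \<in> set ts" for T ts
    using that member_le_sum_list[of "internal T" "map internal ts"]
    by (intro dcat_imp_mem_trees) (auto simp: forests_def)
  then show "forests d r k \<subseteq> tuples (trees d (Suc k)) r"
    by (auto simp: tuples_def forests_def simp del: trees.simps)
qed simp

lemma forests_0: "forests d 0 k = (if k = 0 then {[]} else {})"
  by (auto simp: forests_def)

lemma forests_Suc_0: "forests d (Suc r) 0 = (#) (Nd []) ` forests d r 0"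
  by (auto simp: forests_def length_Suc_conv image_iff)

lemma forests_Suc_Suc:
  assumes "d \<ge> 1"
  shows "forests d (Suc r) (Suc k) = (#) (Nd []) ` forests d r (Suc k)
    \<union> (\<lambda>ws. Nd (take d ws) # drop d ws) ` forests d (d + r) k" (is "?L = ?A \<union> ?B")
proof (intro equalityI subsetI)
  fix ts assume ts: "ts \<in> ?L"
  then obtain us ts' where eq: "ts = Nd us # ts'" "length ts' = r"
    by (auto simp: forests_def length_Suc_conv) (metis ptree.exhaust)
  show "ts \<in> ?A \<union> ?B"
  proof (cases "us = []")
    case True
    then show ?thesis using ts eq by (auto simp: forests_def)
  next
    case False
    then have "us @ ts' \<in> forests d (d + r) k" "length us = d"
      using ts eq by (auto simp: forests_def list_all_iff)
    then have "ts \<in> ?B" using eq by (auto intro!: image_eqI[of _ _ "us @ ts'"])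
    then show ?thesis by blast
  qed
next
  fix ts assume "ts \<in> ?A \<union> ?B"
  then show "ts \<in> ?L"
  proof
    assume "ts \<in> ?B"
    then obtain ws where ws: "ts = Nd (take d ws) # drop d ws" "ws \<in> forests d (d + r) k" by auto
    define us vs where "us = take d ws" and "vs = drop d ws"
    have "ws = us @ vs" "length us = d" using ws by (auto simp: us_def vs_def forests_def)
    then show ?thesis
      using ws assms by (auto simp: forests_def list_all_iff)
  qed (auto simp: forests_def)
qed

lemma card_forests_Suc_Suc:
  assumes "d \<ge> 1"
  shows "card (forests d (Suc r) (Suc k)) = card (forests d r (Suc k)) + card (forests d (d + r) k)"
proof -
  have "take d ws \<noteq> []" if "ws \<in> forests d (d + r) k" for ws
    using that assms by (auto simp: forests_def)
  then have "(#) (Nd []) ` forests d r (Suc k)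
      \<inter> (\<lambda>ws. Nd (take d ws) # drop d ws) ` forests d (d + r) k = {}" by fastforce
  moreover have "inj_on (\<lambda>ws. Nd (take d ws) # drop d ws) (forests d (d + r) k)"
    by (rule inj_onI) (metis append_take_drop_id list.inject ptree.inject)
  ultimately show ?thesis
    unfolding forests_Suc_Suc[OF assms] by (simp add: card_Un_disjoint card_image)
qed

lemma forest_number_rec:
  fixes N N' :: nat
  assumes "d \<ge> 1" and M: "M = d * Suc k + r"
    and N: "M * N = r * (M choose Suc k)" and N': "M * N' = (d + r) * (M choose k)"
  shows "Suc M * (N + N') = Suc r * (Suc M choose Suc k)"
proof -
  define b b' where "b = int (M choose Suc k)" and "b' = int (M choose k)"
  have "Suc k \<le> d * Suc k" using assms(1) by (metis mult_le_mono1 nat_mult_1)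
  then have M_bounds: "k \<le> M" "M \<ge> 1" using M by linarith+
  have "Suc k * (M choose Suc k) = (M - k) * (M choose k)"
    by (simp only: binomial_absorption binomial_absorb_comp)
  then have absorb: "(int k + 1) * b = (int M - int k) * b'"
    unfolding b_def b'_def using M_bounds by (metis of_nat_Suc of_nat_diff of_nat_mult add.commute)
  have int_M: "int M = int d * (int k + 1) + int r" by (simp add: M algebra_simps)
  have int_N: "int M * int N = int r * b" "int M * int N' = (int d + int r) * b'"
    using N N' by (metis b_def b'_def of_nat_mult of_nat_add)+
  have "int M * ((int M + 1) * (int N + int N')) = int M * ((int r + 1) * (b' + b))"
    using int_N absorb int_M by algebra
  then have "(int M + 1) * (int N + int N') = (int r + 1) * (b' + b)" using M_bounds by simp
  then have "int (Suc M * (N + N')) = int (Suc r * (Suc M choose Suc k))"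
    by (simp add: b_def b'_def algebra_simps)
  then show ?thesis by (simp only: of_nat_eq_iff)
qed

lemma card_forests:
  assumes "d \<ge> 1"
  shows "(d * k + r) * card (forests d r k) = r * ((d * k + r) choose k)"
proof (induction k arbitrary: r)
  case 0
  have "card (forests d r 0) = 1"
    by (induction r) (simp_all add: forests_0 forests_Suc_0 card_image)
  then show ?case by simp
next
  case (Suc k)
  note fewer_internal = Suc.IH
  show ?case
  proof (induction r)
    case (Suc r)
    have "(d * Suc k + r) * card (forests d (d + r) k) = (d + r) * ((d * Suc k + r) choose k)"
      using fewer_internal[of "d + r"] by (simp add: algebra_simps)
    from forest_number_rec[OF assms refl Suc.IH this] show ?case
      unfolding card_forests_Suc_Suc[OF assms] by simp
  qed (simp add: forests_0)
qed

lemma card_catalan: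
  assumes "d \<ge> 1"
  shows "((d - 1) * k + 1) * card (catalan d k) = (d * k choose k)"
proof -
  have "forests d 1 k = (\<lambda>T. [T]) ` catalan d k"
    by (auto simp: catalan_def forests_def length_Suc_conv)
  then have "card (forests d 1 k) = card (catalan d k)" by (simp add: card_image inj_on_def)
  then have forests: "Suc (d * k) * card (catalan d k) = (Suc (d * k) choose k)"
    using card_forests[OF assms, of k 1] by simp
  have "Suc (d * k) - k = (d - 1) * k + 1" using assms by (cases d) (auto simp: algebra_simps)
  then have "((d - 1) * k + 1) * (Suc (d * k) choose k) = Suc (d * k) * (d * k choose k)"
    using binomial_absorb_comp[of "Suc (d * k)" k] by simp
  then have "Suc (d * k) * (((d - 1) * k + 1) * card (catalan d k))
    = Suc (d * k) * (d * k choose k)"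
    unfolding forests[symmetric] by (metis mult.left_commute)
  then show ?thesis by (simp only: mult_cancel1) simp
qed

lemma card_catalan_pos:
  assumes "d \<ge> 1"
  shows "card (catalan d k) > 0"
proof -
  have "(d * k choose k) > 0" using assms by simp
  then show ?thesis using card_catalan[OF assms, of k] by (metis nat_0_less_mult_iff)
qed

section \<open>Trees avoiding a fringe subtree\<close>

definition subtrees :: "ptree \<Rightarrow> ptree set" where
  "subtrees T = {subt T v | v. ispos T v}"

lemma subtrees_Nd: "subtrees (Nd ts) = insert (Nd ts) (\<Union>t\<in>set ts. subtrees t)"
proof (intro equalityI subsetI)
  fix s assume "s \<in> subtrees (Nd ts)"
  then obtain v where "s = subt (Nd ts) v" "ispos (Nd ts) v" by (auto simp: subtrees_def)
  then show "s \<in> insert (Nd ts) (\<Union>t\<in>set ts. subtrees t)"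
    by (cases v) (auto simp: subtrees_def)
next
  fix s assume "s \<in> insert (Nd ts) (\<Union>t\<in>set ts. subtrees t)"
  then consider "s = Nd ts" | c v where "c < length ts" "s = subt (ts ! c) v" "ispos (ts ! c) v"
    by (auto simp: subtrees_def in_set_conv_nth)
  then show "s \<in> subtrees (Nd ts)"
  proof cases
    case 1
    then show ?thesis by (auto simp: subtrees_def intro: exI[of _ "[]"])
  next
    case (2 c v)
    then show ?thesis by (auto simp: subtrees_def intro!: exI[of _ "c # v"])
  qed
qed

lemma leaf_mem_subtrees: "Nd [] \<in> subtrees T"
proof (induction T)
  case (Nd ts)
  then show ?case by (cases ts) (auto simp: subtrees_Nd)
qed

lemma internal_subtree_le: "s \<in> subtrees T \<Longrightarrow> internal s \<le> internal T"
proof (induction T)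
  case (Nd ts)
  show ?case
  proof (cases "s = Nd ts")
    case False
    then obtain t where "t \<in> set ts" "s \<in> subtrees t" using Nd.prems by (auto simp: subtrees_Nd)
    then show ?thesis using Nd.IH internal_child_less[of t ts] by fastforce
  qed simp
qed

lemma power_sum_list: "x ^ sum_list (map f xs) = (\<Prod>y\<leftarrow>xs. x ^ f y)"
  by (induction xs) (simp_all add: power_add)

lemma sum_power_internal_Nd:
  fixes x :: "'a :: comm_semiring_1"
  assumes "d \<ge> 1"
  shows "(\<Sum>T\<in>Nd ` tuples A d. x ^ internal T) = x * (\<Sum>T\<in>A. x ^ internal T) ^ d"
proof -
  have "(\<Sum>T\<in>Nd ` tuples A d. x ^ internal T) = (\<Sum>us\<in>tuples A d. x * (\<Prod>u\<leftarrow>us. x ^ internal u))"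
    using assms by (subst sum.reindex)
      (auto simp: inj_on_def tuples_def power_sum_list comp_def intro!: sum.cong)
  then show ?thesis by (simp add: power_sum_conv_tuples sum_distrib_left)
qed

lemma sum_power_internal_leaf_Nd:
  fixes x :: "'a :: comm_semiring_1"
  assumes "d \<ge> 1" "finite A"
  shows "(\<Sum>T\<in>insert (Nd []) (Nd ` tuples A d). x ^ internal T) = 1 + x * (\<Sum>T\<in>A. x ^ internal T) ^ d"
proof -
  have "Nd [] \<notin> Nd ` tuples A d" using assms(1) by (auto simp: tuples_def)
  then show ?thesis using assms by (simp add: sum_power_internal_Nd)
qed

definition avoiding :: "nat \<Rightarrow> ptree \<Rightarrow> nat \<Rightarrow> ptree set" where
  "avoiding d s h = {T \<in> trees d h. s \<notin> subtrees T}"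

lemma finite_avoiding [simp]: "finite (avoiding d s h)"
  by (simp add: avoiding_def)

lemma insert_avoiding_Suc:
  assumes s: "s \<in> trees d (Suc h)" "s \<noteq> Nd []"
  shows "insert s (avoiding d s (Suc h)) = insert (Nd []) (Nd ` tuples (avoiding d s h) d)"
proof -
  obtain us where us: "s = Nd us" "us \<in> tuples (trees d h) d" using s by auto
  have "s \<notin> subtrees u" if "u \<in> set us" for u
    using internal_child_less[OF that] internal_subtree_le[of s u] unfolding us(1) by linarith
  then have "s \<in> Nd ` tuples (avoiding d s h) d"
    using us by (auto simp: tuples_def avoiding_def)
  then show ?thesis
    using s(2) by (auto simp: avoiding_def tuples_def subtrees_Nd image_iff)
qed

lemma sum_power_internal_avoiding_Suc:
  fixes x :: "'a :: comm_semiring_1"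
  assumes "d \<ge> 1" "s \<in> trees d (Suc h)" "s \<noteq> Nd []"
  shows "x ^ internal s + (\<Sum>T\<in>avoiding d s (Suc h). x ^ internal T)
    = 1 + x * (\<Sum>T\<in>avoiding d s h. x ^ internal T) ^ d"
proof -
  have "s \<notin> avoiding d s (Suc h)" by (cases s) (simp add: avoiding_def subtrees_Nd)
  then have "x ^ internal s + (\<Sum>T\<in>avoiding d s (Suc h). x ^ internal T)
    = (\<Sum>T\<in>insert s (avoiding d s (Suc h)). x ^ internal T)" by simp
  also have "\<dots> = 1 + x * (\<Sum>T\<in>avoiding d s h. x ^ internal T) ^ d"
    unfolding insert_avoiding_Suc[OF assms(2,3)] using assms(1)
    by (intro sum_power_internal_leaf_Nd) simp_all
  finally show ?thesis .
qed

definition catalan_radius :: "nat \<Rightarrow> real" where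
  "catalan_radius d = real (d - 1) ^ (d - 1) / real d ^ d"

lemma catalan_radius_pos: "d \<ge> 2 \<Longrightarrow> catalan_radius d > 0"
  by (simp add: catalan_radius_def)

lemma catalan_radius_fixpoint:
  assumes "d \<ge> 2"
  shows "1 + catalan_radius d * (real d / real (d - 1)) ^ d = real d / real (d - 1)"
proof -
  have "catalan_radius d * (real d / real (d - 1)) ^ d = real (d - 1) ^ (d - 1) / real (d - 1) ^ d"
    using assms by (simp add: catalan_radius_def power_divide)
  also have "\<dots> = 1 / real (d - 1)" using assms by (cases d) auto
  finally have "1 + catalan_radius d * (real d / real (d - 1)) ^ d = 1 + 1 / real (d - 1)" by simp
  also have "\<dots> = real d / real (d - 1)" using assms by (simp add: field_simps of_nat_diff)
  finally show ?thesis .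
qed

lemma sum_trees_radius_less:
  assumes d: "d \<ge> 2"
  shows "(\<Sum>T\<in>trees d h. catalan_radius d ^ internal T) < real d / real (d - 1)"
proof (induction h)
  case 0
  show ?case using d by simp
next
  case (Suc h)
  let ?\<rho> = "catalan_radius d"
  have "(\<Sum>T\<in>trees d (Suc h). ?\<rho> ^ internal T) = 1 + ?\<rho> * (\<Sum>T\<in>trees d h. ?\<rho> ^ internal T) ^ d"
    unfolding trees.simps using d by (intro sum_power_internal_leaf_Nd) simp_all
  also have "\<dots> < 1 + ?\<rho> * (real d / real (d - 1)) ^ d"
    using Suc d catalan_radius_pos[OF d]
    by (intro add_strict_left_mono mult_strict_left_mono power_strict_mono sum_nonneg) auto
  finally show ?case unfolding catalan_radius_fixpoint[OF d] .
qed

text \<open>The term \<open>x ^ internal s\<close> gained in the recursion for the avoiding trees leaves room to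
  increase the argument beyond the radius of convergence of the Catalan series.\<close>

lemma sum_power_internal_avoiding_le:
  fixes x y \<rho> :: real
  assumes d: "d \<ge> 1" and s: "dcat d s" "s \<noteq> Nd []"
    and \<rho>: "0 < \<rho>" "\<rho> \<le> x" and y: "0 \<le> y" "1 + \<rho> * y ^ d = y"
    and start: "(\<Sum>T\<in>trees d (Suc (internal s)). x ^ internal T) \<le> y"
    and room: "(x - \<rho>) * y ^ d \<le> \<rho> ^ internal s"
  shows "(\<Sum>T\<in>avoiding d s h. x ^ internal T) \<le> y"
proof (induction h)
  case 0
  show ?case using y by (simp add: avoiding_def)
next
  case (Suc h)
  show ?case
  proof (cases "h < internal s")
    case True
    then have "avoiding d s (Suc h) \<subseteq> trees d (Suc (internal s))"
      using trees_mono[of "Suc h" "Suc (internal s)" d]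
      by (auto simp: avoiding_def simp del: trees.simps)
    then have "(\<Sum>T\<in>avoiding d s (Suc h). x ^ internal T)
      \<le> (\<Sum>T\<in>trees d (Suc (internal s)). x ^ internal T)"
      using \<rho> by (intro sum_mono2) auto
    then show ?thesis using start by simp
  next
    case False
    then have "s \<in> trees d (Suc h)" using s(1) by (intro dcat_imp_mem_trees) auto
    have "\<rho> ^ internal s + (\<Sum>T\<in>avoiding d s (Suc h). x ^ internal T)
      \<le> x ^ internal s + (\<Sum>T\<in>avoiding d s (Suc h). x ^ internal T)"
      using \<rho> by (intro add_right_mono power_mono) auto
    also have "\<dots> = 1 + x * (\<Sum>T\<in>avoiding d s h. x ^ internal T) ^ d"
      using d s \<open>s \<in> trees d (Suc h)\<close> by (intro sum_power_internal_avoiding_Suc) auto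
    also have "\<dots> \<le> 1 + x * y ^ d"
      using Suc \<rho> by (intro add_left_mono mult_left_mono power_mono sum_nonneg) auto
    also have "\<dots> = y + (x - \<rho>) * y ^ d" using y(2) by (simp add: algebra_simps)
    finally show ?thesis using room by linarith
  qed
qed

lemma ex_avoiding_argument_gt_radius:
  assumes d: "d \<ge> 2" and s: "dcat d s" "s \<noteq> Nd []"
  shows "\<exists>x>catalan_radius d. \<forall>h. (\<Sum>T\<in>avoiding d s h. x ^ internal T) \<le> real d / real (d - 1)"
proof -
  define y \<rho> where "y = real d / real (d - 1)" and "\<rho> = catalan_radius d"
  have \<rho>: "\<rho> > 0" "1 + \<rho> * y ^ d = y"
    using catalan_radius_pos[OF d] catalan_radius_fixpoint[OF d] by (simp_all add: \<rho>_def y_def)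
  let ?start = "\<lambda>x. \<Sum>T\<in>trees d (Suc (internal s)). x ^ internal T"
  have "(?start \<longlongrightarrow> ?start \<rho>) (at_right \<rho>)" by (intro tendsto_intros)
  then have "eventually (\<lambda>x. ?start x < y) (at_right \<rho>)"
    using sum_trees_radius_less[OF d] unfolding \<rho>_def y_def by (rule order_tendstoD)
  moreover have "((\<lambda>x. (x - \<rho>) * y ^ d) \<longlongrightarrow> (\<rho> - \<rho>) * y ^ d) (at_right \<rho>)"
    by (intro tendsto_intros)
  then have "eventually (\<lambda>x. (x - \<rho>) * y ^ d < \<rho> ^ internal s) (at_right \<rho>)"
    using \<rho>(1) by (intro order_tendstoD) auto
  ultimately have "eventually
      (\<lambda>x. x > \<rho> \<and> ?start x < y \<and> (x - \<rho>) * y ^ d < \<rho> ^ internal s) (at_right \<rho>)"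
    using eventually_at_right_less by eventually_elim auto
  then obtain x where x: "x > \<rho>" "?start x < y" "(x - \<rho>) * y ^ d < \<rho> ^ internal s"
    by (metis (mono_tags, lifting) eventually_happens' trivial_limit_at_right_real)
  then have "(\<Sum>T\<in>avoiding d s h. x ^ internal T) \<le> y" for h
    using d s \<rho> by (intro sum_power_internal_avoiding_le[of d s \<rho>]) (auto simp: y_def)
  then show ?thesis using x(1) by (auto simp: \<rho>_def y_def)
qed

lemma binomial_term_ratio:
  fixes q :: nat
  assumes "i < N"
  shows "Suc i * q * ((N choose Suc i) * q ^ (N - Suc i)) = (N - i) * ((N choose i) * q ^ (N - i))"
proof -
  have "Suc i * (N choose Suc i) = (N - i) * (N choose i)"
    by (simp only: binomial_absorption binomial_absorb_comp)
  moreover have "q * q ^ (N - Suc i) = q ^ (N - i)"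
    using assms by (metis Suc_diff_Suc power_Suc)
  ultimately show ?thesis by (metis mult.assoc mult.left_commute)
qed

lemma binomial_term_le_mode:
  fixes d k j :: nat
  assumes d: "d \<ge> 2" and j: "j \<le> d * k"
  shows "(d * k choose j) * (d - 1) ^ (d * k - j) \<le> (d * k choose k) * (d - 1) ^ (d * k - k)"
proof -
  define N t where "N = d * k" and "t i = (N choose i) * (d - 1) ^ (N - i)" for i
  have N: "k \<le> N" "N - k = k * (d - 1)" using d by (simp_all add: N_def algebra_simps)
  note ratio = binomial_term_ratio[of _ N "d - 1", folded t_def]
  have up: "t i \<le> t (Suc i)" if "i < k" for i
  proof -
    have "Suc i * (d - 1) \<le> N - i"
      using mult_le_mono1[of "Suc i" k "d - 1"] N that by linarith
    then have "Suc i * (d - 1) * t i \<le> Suc i * (d - 1) * t (Suc i)"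
      using ratio[of i] N that by (simp only: mult_le_mono1)
    then show ?thesis using d by simp
  qed
  have down: "t (Suc i) \<le> t i" if "k \<le> i" "i < N" for i
  proof -
    have "N - i \<le> Suc i * (d - 1)"
      using mult_le_mono1[of k "Suc i" "d - 1"] N that by linarith
    then have "Suc i * (d - 1) * t (Suc i) \<le> Suc i * (d - 1) * t i"
      using ratio[of i] that by (simp only: mult_le_mono1)
    then show ?thesis using d by simp
  qed
  have "t j \<le> t k"
  proof (cases "j \<le> k")
    case True
    then show ?thesis by (induction rule: inc_induct) (auto intro: up order_trans)
  next
    case False
    then have "k \<le> j" by simp
    then show ?thesis using j unfolding N_def[symmetric]
      by (induction rule: dec_induct) (auto intro: order_trans[OF down])
  qed
  then show ?thesis by (simp add: t_def N_def)
qed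

lemma power_le_binomial_mode:
  fixes d k :: nat
  assumes "d \<ge> 2"
  shows "d ^ (d * k) \<le> (d * k + 1) * ((d * k choose k) * (d - 1) ^ ((d - 1) * k))"
proof -
  have "d ^ (d * k) = (1 + (d - 1)) ^ (d * k)" using assms by simp
  also have "\<dots> = (\<Sum>j\<le>d * k. (d * k choose j) * (d - 1) ^ (d * k - j))"
    by (subst binomial_ring) simp
  also have "\<dots> \<le> (\<Sum>j\<le>d * k. (d * k choose k) * (d - 1) ^ (d * k - k))"
    using assms by (intro sum_mono binomial_term_le_mode) auto
  finally show ?thesis by (simp add: diff_mult_distrib)
qed

lemma card_catalan_lower_bound:
  assumes "d \<ge> 2"
  shows "1 \<le> real (d * k + 1) ^ 2 * catalan_radius d ^ k * real (card (catalan d k))"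
proof -
  let ?N = "d * k + 1" and ?c = "card (catalan d k)" and ?p = "(d - 1) ^ ((d - 1) * k)"
  have "d ^ (d * k) \<le> ?N * ((d * k choose k) * ?p)" using assms by (rule power_le_binomial_mode)
  also have "(d * k choose k) = ((d - 1) * k + 1) * ?c" using assms card_catalan[of d k] by simp
  also have "?N * (((d - 1) * k + 1) * ?c * ?p) \<le> ?N * (?N * ?c * ?p)"
    by (intro mult_le_mono) auto
  finally have "real (d ^ (d * k)) \<le> real (?N * (?N * ?c * ?p))" by (rule of_nat_mono)
  also have "\<dots> = real ?N ^ 2 * real ?p * real ?c"
    by (simp only: of_nat_mult power2_eq_square mult_ac)
  finally have "1 \<le> real ?N ^ 2 * real ?p * real ?c / real (d ^ (d * k))"
    using assms by (subst le_divide_eq_1_pos) auto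
  moreover have "catalan_radius d ^ k = real ?p / real (d ^ (d * k))"
    by (simp add: catalan_radius_def power_divide power_mult)
  ultimately show ?thesis by (simp only: times_divide_eq_right times_divide_eq_left)
qed

lemma square_linear_mult_power_bounded:
  fixes a b r :: real
  assumes "0 < r" "r < 1"
  shows "\<exists>C>0. \<forall>k. (a * real k + b) ^ 2 * r ^ k \<le> C"
proof -
  define q where "q = sqrt r"
  have q: "0 < q" "q < 1" "r = q ^ 2" using assms by (simp_all add: q_def)
  have "(\<lambda>k. a * (real k * q ^ k) + b * q ^ k) \<longlonglongrightarrow> a * 0 + b * 0"
    using q powser_times_n_limit_0[of q] LIMSEQ_realpow_zero[of q] by (intro tendsto_intros) auto
  then obtain C where C: "C > 0" "\<And>k. norm (a * (real k * q ^ k) + b * q ^ k) \<le> C"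
    by (meson BseqE convergentI convergent_imp_Bseq)
  have "(a * real k + b) ^ 2 * r ^ k \<le> C ^ 2" for k
  proof -
    have "(a * real k + b) ^ 2 * r ^ k = (a * (real k * q ^ k) + b * q ^ k) ^ 2"
      by (simp add: q power2_eq_square power_mult_distrib algebra_simps)
    also have "\<dots> \<le> C ^ 2" using C by (intro power2_le_iff_abs_le[THEN iffD2]) auto
    finally show ?thesis .
  qed
  then show ?thesis using C(1) by (intro exI[of _ "C ^ 2"]) simp
qed

lemma card_avoiding_mult_power_le:
  fixes x :: real
  assumes "x \<ge> 0"
  shows "real (card {T \<in> catalan d k. s \<notin> subtrees T}) * x ^ k
    \<le> (\<Sum>T\<in>avoiding d s (Suc k). x ^ internal T)"
proof -
  have "real (card {T \<in> catalan d k. s \<notin> subtrees T}) * x ^ k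
    = (\<Sum>T | T \<in> catalan d k \<and> s \<notin> subtrees T. x ^ internal T)"
    by (simp add: catalan_def)
  also have "\<dots> \<le> (\<Sum>T\<in>avoiding d s (Suc k). x ^ internal T)"
    using assms catalan_subset_trees
    by (intro sum_mono2) (auto simp: avoiding_def simp del: trees.simps)
  finally show ?thesis .
qed

lemma card_catalan_avoiding_exp_le:
  assumes d: "d \<ge> 2" and "dcat d s"
  shows "\<exists>C>0. \<exists>c>0. \<forall>k. real (card {T \<in> catalan d k. s \<notin> subtrees T})
           \<le> C * exp (- c * real k) * real (card (catalan d k))"
proof (cases "s = Nd []")
  case True
  then show ?thesis using leaf_mem_subtrees by (auto intro!: exI[of _ "1 :: real"])
next
  case False
  define y \<rho> where "y = real d / real (d - 1)" and "\<rho> = catalan_radius d"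
  obtain x where x: "x > \<rho>" and le_y: "\<And>h. (\<Sum>T\<in>avoiding d s h. x ^ internal T) \<le> y"
    using ex_avoiding_argument_gt_radius[OF assms False] by (auto simp: \<rho>_def y_def)
  have pos: "\<rho> > 0" "x > 0" "y > 0" using catalan_radius_pos[OF d] x d by (auto simp: \<rho>_def y_def)
  define r where "r = sqrt (\<rho> / x)"
  have r: "0 < r" "r < 1" "\<rho> / x = r * r" using x pos by (simp_all add: r_def)
  obtain B where B: "B > 0" "\<And>k. real (d * k + 1) ^ 2 * r ^ k \<le> B"
    using square_linear_mult_power_bounded[OF r(1,2), of "real d" 1] by (auto simp: add.commute)
  have "real (card {T \<in> catalan d k. s \<notin> subtrees T})
     \<le> y * B * exp (- (- ln r) * real k) * real (card (catalan d k))" for k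
  proof -
    let ?a = "real (card {T \<in> catalan d k. s \<notin> subtrees T})" and ?c = "real (card (catalan d k))"
    have "?a * x ^ k \<le> y"
      using card_avoiding_mult_power_le[of x d k s] le_y[of "Suc k"] pos by linarith
    then have "?a \<le> y / x ^ k" using pos by (simp add: field_simps)
    also have "\<dots> \<le> y / x ^ k * (real (d * k + 1) ^ 2 * \<rho> ^ k * ?c)"
      using mult_left_mono[OF card_catalan_lower_bound[OF d, of k], of "y / x ^ k"] pos
      by (simp add: \<rho>_def)
    also have "\<dots> = y * (real (d * k + 1) ^ 2 * (\<rho> / x) ^ k) * ?c" by (simp add: power_divide)
    also have "(\<rho> / x) ^ k = r ^ k * r ^ k" unfolding r(3) by (rule power_mult_distrib)
    also have "y * (real (d * k + 1) ^ 2 * (r ^ k * r ^ k)) * ?c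
      = y * (real (d * k + 1) ^ 2 * r ^ k) * r ^ k * ?c" by simp
    also have "\<dots> \<le> y * B * r ^ k * ?c"
      using B(2)[of k] pos r by (intro mult_right_mono mult_left_mono) auto
    also have "r ^ k = exp (- (- ln r) * real k)" using r(1) by (simp add: exp_of_nat2_mult)
    finally show ?thesis .
  qed
  moreover have "y * B > 0" "- ln r > 0" using pos B r by simp_all
  ultimately show ?thesis by blast
qed

section \<open>Shuffle classes as sets of rearranged combs\<close>

lemma ispos_append: "ispos T (v @ w) \<longleftrightarrow> ispos T v \<and> ispos (subt T v) w"
  by (induction T v rule: ispos.induct) auto

lemma subt_append: "ispos T v \<Longrightarrow> subt T (v @ w) = subt (subt T v) w"
  by (induction T v rule: ispos.induct) auto

lemma repl_append: "ispos T v \<Longrightarrow> repl T (v @ w) S = repl T v (repl (subt T v) w S)"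
  by (induction T v rule: ispos.induct) auto

lemma repl_subt_self: "ispos T v \<Longrightarrow> repl T v (subt T v) = T"
  by (induction T v rule: ispos.induct) auto

lemma subt_repl: "ispos T v \<Longrightarrow> subt (repl T v S) v = S"
  by (induction T v rule: ispos.induct) auto

lemma repl_repl: "ispos T v \<Longrightarrow> repl (repl T v R) v S = repl T v S"
  by (induction T v rule: ispos.induct) auto

lemma ispos_repl: "ispos T v \<Longrightarrow> ispos (repl T v S) v"
  by (induction T v rule: ispos.induct) auto

lemma dcat_subt: "ispos T v \<Longrightarrow> dcat d T \<Longrightarrow> dcat d (subt T v)"
  by (induction T v rule: ispos.induct) (auto simp: list_all_length)

lemma dcat_repl: "ispos T v \<Longrightarrow> dcat d T \<Longrightarrow> dcat d S \<Longrightarrow> dcat d (repl T v S)"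
  by (induction T v rule: ispos.induct) (auto simp: list_all_length nth_list_update)

lemma internal_repl:
  "ispos T v \<Longrightarrow> internal S = internal (subt T v) \<Longrightarrow> internal (repl T v S) = internal T"
proof (induction T v rule: ispos.induct)
  case (2 ts c cs)
  then have "internal (repl (ts ! c) cs S) = internal (ts ! c)" by simp
  then have "map internal (ts[c := repl (ts ! c) cs S]) = map internal ts"
    by (metis list_update_id map_update)
  then show ?case using 2(2) by simp
qed simp

lemma is_path_iff_ispos: "is_path T v cs \<longleftrightarrow> ispos T (v @ cs)"
proof -
  have "(\<forall>i<length cs. is_internal S (take i cs) \<and>
      cs ! i < length (case subt S (take i cs) of Nd ts \<Rightarrow> ts)) \<longleftrightarrow> ispos S cs" for S
  proof (induction cs arbitrary: S)
    case (Cons c cs)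
    obtain ts where S: "S = Nd ts" by (cases S)
    show ?case
      unfolding length_Cons All_less_Suc2 using Cons[of "ts ! c"]
      by (auto simp: S is_internal_def split: if_splits)
  qed simp
  moreover have "ispos T v \<Longrightarrow> is_internal T (v @ w) \<longleftrightarrow> is_internal (subt T v) w" for w
    by (auto simp: is_internal_def ispos_append subt_append)
  ultimately show ?thesis
    unfolding is_path_def ispos_append by (metis subt_append)
qed

lemma sibpos_prefix: "sibpos d v cs = map ((@) v) (sibpos d [] cs)"
  by (simp add: sibpos_def map_concat comp_def)

lemma sibpos_Nil [simp]: "sibpos d v [] = []"
  by (simp add: sibpos_def)

lemma sibpos_Cons:
  assumes "c < d"
  shows "sibpos d [] (c # cs)
    = map (\<lambda>j. [j]) ([0..<c] @ [Suc c..<d]) @ map ((#) c) (sibpos d [] cs)"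
proof -
  have "[0..<d] = [0..<c] @ c # [Suc c..<d]"
    using assms upt_add_eq_append[of 0 c "d - c"] by (simp add: upt_conv_Cons)
  then have "filter (\<lambda>j. j \<noteq> c) [0..<d] = [0..<c] @ [Suc c..<d]"
    by (simp add: filter_id_conv)
  moreover have "[0..<Suc (length cs)] = 0 # map Suc [0..<length cs]"
    by (simp add: upt_conv_Cons map_Suc_upt del: upt_Suc)
  ultimately show ?thesis
    by (simp add: sibpos_def comp_def map_concat del: upt_Suc)
qed

lemma length_sibpos: "\<forall>c\<in>set cs. c < d \<Longrightarrow> length (sibpos d [] cs) = (d - 1) * length cs"
  by (induction cs) (auto simp: sibpos_Cons)

lemma ispos_children_less: "ispos T cs \<Longrightarrow> dcat d T \<Longrightarrow> \<forall>c\<in>set cs. c < d"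
  by (induction T cs rule: ispos.induct) (auto simp: list_all_length)

lemma ispos_sibpos: "ispos T cs \<Longrightarrow> dcat d T \<Longrightarrow> q \<in> set (sibpos d [] cs) \<Longrightarrow> ispos T q"
proof (induction T cs arbitrary: q rule: ispos.induct)
  case (2 ts c cs)
  then have "length ts = d" "c < d" "dcat d (ts ! c)" by (auto simp: list_all_length)
  then show ?case using 2 by (auto simp: sibpos_Cons)
qed simp

text \<open>As in \<^const>\<open>sibpos\<close>, the subtrees beside the path are listed level by level from the root
  downwards, \<open>d - 1\<close> for each level.\<close>

fun comb :: "nat \<Rightarrow> nat list \<Rightarrow> ptree list \<Rightarrow> ptree \<Rightarrow> ptree" where
  "comb d [] xs B = B"
| "comb d (c # cs) xs B = Nd (insert_at c (comb d cs (drop (d - 1) xs) B) (take (d - 1) xs))"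

lemma comb_inject:
  assumes "\<forall>c\<in>set cs. c < d" "length xs = (d - 1) * length cs" "length ys = (d - 1) * length cs"
    and "comb d cs xs B = comb d cs ys B"
  shows "xs = ys"
  using assms
proof (induction cs arbitrary: xs ys)
  case (Cons c cs)
  have "comb d cs (drop (d - 1) xs) B = comb d cs (drop (d - 1) ys) B
    \<and> take (d - 1) xs = take (d - 1) ys"
    using Cons.prems by (intro insert_at_inject[of c]) auto
  moreover from this have "drop (d - 1) xs = drop (d - 1) ys"
    using Cons by auto
  ultimately show ?case by (metis append_take_drop_id)
qed simp

lemma internal_comb:
  "length xs = (d - 1) * length cs \<Longrightarrow>
    internal (comb d cs xs B) = length cs + sum_list (map internal xs) + internal B"
proof (induction cs arbitrary: xs)
  case (Cons c cs)
  have "sum_list (map internal xs)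
    = sum_list (map internal (take (d - 1) xs)) + sum_list (map internal (drop (d - 1) xs))"
    by (metis append_take_drop_id map_append sum_list_append)
  then show ?case using Cons by (simp add: sum_list_map_insert_at)
qed simp

lemma dcat_comb:
  assumes "\<forall>c\<in>set cs. c < d" "length xs = (d - 1) * length cs" "\<forall>x\<in>set xs. dcat d x" "dcat d B"
  shows "dcat d (comb d cs xs B)"
  using assms
proof (induction cs arbitrary: xs)
  case (Cons c cs)
  then have "dcat d (comb d cs (drop (d - 1) xs) B)"
    by (intro Cons.IH) (auto dest: in_set_dropD)
  then show ?case using Cons.prems by (auto simp: list_all_iff dest: in_set_takeD)
qed simp

lemma repl_all_Nil [simp]: "repl_all T [] = T"
  and repl_all_Cons [simp]: "repl_all T ((q, S) # rs) = repl_all (repl T q S) rs"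
  and repl_all_append: "repl_all T (rs @ rs') = repl_all (repl_all T rs) rs'"
  by (simp_all add: repl_all_def)

lemma repl_all_prefix:
  assumes "ispos T v"
  shows "repl_all T (zip (map ((@) v) P) xs) = repl T v (repl_all (subt T v) (zip P xs))"
  using assms
proof (induction P arbitrary: T xs)
  case (Cons q P)
  show ?case
  proof (cases xs)
    case xs: (Cons x xs')
    have "repl_all T (zip (map ((@) v) (q # P)) xs)
      = repl (repl T v (repl (subt T v) q x)) v (repl_all (repl (subt T v) q x) (zip P xs'))"
      using Cons by (simp add: xs repl_append ispos_repl subt_repl)
    then show ?thesis using Cons by (simp add: xs repl_repl)
  qed (use Cons in \<open>simp add: repl_subt_self\<close>)
qed (simp add: repl_subt_self)

lemma repl_all_interval:
  assumes "length ys = b - a" "a \<le> b" "b \<le> length ts"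
  shows "repl_all (Nd ts) (zip (map (\<lambda>j. [j]) [a..<b]) ys) = Nd (take a ts @ ys @ drop b ts)"
  using assms
proof (induction ys arbitrary: a ts)
  case (Cons y ys)
  then have "a < b" by auto
  then have "repl_all (Nd ts) (zip (map (\<lambda>j. [j]) [a..<b]) (y # ys))
    = Nd (take (Suc a) (ts[a := y]) @ ys @ drop b (ts[a := y]))"
    using Cons by (simp add: upt_conv_Cons)
  also have "take (Suc a) (ts[a := y]) = take a ts @ [y]"
    using Cons \<open>a < b\<close> by (simp add: take_Suc_conv_app_nth)
  finally show ?case using \<open>a < b\<close> by simp
qed simp

lemma repl_all_siblings:
  assumes "c < length ts" "Suc (length ys) = length ts"
  shows "repl_all (Nd ts) (zip (map (\<lambda>j. [j]) ([0..<c] @ [Suc c..<length ts])) ys)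
    = Nd (insert_at c (ts ! c) ys)"
proof -
  let ?ts = "take c ys @ drop c ts"
  have "zip (map (\<lambda>j. [j]) ([0..<c] @ [Suc c..<length ts])) ys
    = zip (map (\<lambda>j. [j]) [0..<c]) (take c ys) @ zip (map (\<lambda>j. [j]) [Suc c..<length ts]) (drop c ys)"
    by (simp add: zip_append1)
  moreover have "repl_all (Nd ts) (zip (map (\<lambda>j. [j]) [0..<c]) (take c ys)) = Nd ?ts"
    using assms by (subst repl_all_interval) auto
  moreover have "repl_all (Nd ?ts) (zip (map (\<lambda>j. [j]) [Suc c..<length ts]) (drop c ys))
    = Nd (take (Suc c) ?ts @ drop c ys)"
    using assms by (subst repl_all_interval) auto
  moreover have "take (Suc c) ?ts = take c ys @ [ts ! c]"
    using assms by (simp add: take_Suc_conv_app_nth nth_append)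
  ultimately show ?thesis by (simp add: repl_all_append insert_at_def)
qed

lemma repl_all_sibpos:
  assumes "dcat d T" "ispos T cs" "length xs = (d - 1) * length cs"
  shows "repl_all T (zip (sibpos d [] cs) xs) = comb d cs xs (subt T cs)"
  using assms
proof (induction cs arbitrary: T xs)
  case (Cons c cs)
  obtain ts where T: "T = Nd ts" by (cases T)
  have ts: "length ts = d" "c < d" "dcat d (ts ! c)" "ispos (ts ! c) cs"
    using Cons.prems by (auto simp: T list_all_length)
  define ys zs where "ys = take (d - 1) xs" and "zs = drop (d - 1) xs"
  have len: "Suc (length ys) = d" "length zs = (d - 1) * length cs"
    using Cons.prems ts(2) by (auto simp: ys_def zs_def)
  have "(@) [c] = (#) c" by (rule ext) simp
  then have "zip (sibpos d [] (c # cs)) (ys @ zs)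
    = zip (map (\<lambda>j. [j]) ([0..<c] @ [Suc c..<d])) ys @ zip (map ((@) [c]) (sibpos d [] cs)) zs"
    using ts len by (simp add: sibpos_Cons flip: map_append)
  then have "repl_all T (zip (sibpos d [] (c # cs)) xs)
    = repl_all (Nd (insert_at c (ts ! c) ys)) (zip (map ((@) [c]) (sibpos d [] cs)) zs)"
    using ts len repl_all_siblings[of c ts ys] by (simp add: T repl_all_append ys_def zs_def)
  also have "\<dots> = repl (Nd (insert_at c (ts ! c) ys)) [c]
      (repl_all (ts ! c) (zip (sibpos d [] cs) zs))"
    using ts len by (subst repl_all_prefix) auto
  also have "repl_all (ts ! c) (zip (sibpos d [] cs) zs) = comb d cs zs (subt (ts ! c) cs)"
    using ts len by (intro Cons.IH) auto
  finally show ?case using ts len by (simp add: T ys_def zs_def)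
qed simp

lemma image_permute_list:
  "(\<lambda>\<sigma>. permute_list \<sigma> ys) ` {\<sigma>. \<sigma> permutes {..<length ys}} = permutations_of_multiset (mset ys)"
proof (intro equalityI subsetI)
  fix xs assume "xs \<in> permutations_of_multiset (mset ys)"
  then obtain \<sigma> where "\<sigma> permutes {..<length ys}" "permute_list \<sigma> ys = xs"
    using mset_eq_permutation permutations_of_multisetD by metis
  then show "xs \<in> (\<lambda>\<sigma>. permute_list \<sigma> ys) ` {\<sigma>. \<sigma> permutes {..<length ys}}" by blast
qed (auto simp: permutations_of_multiset_def)

locale catalan_path =
  fixes d k :: nat and T :: ptree and v cs :: "nat list"
  assumes tree: "T \<in> catalan d k" and path: "is_path T v cs"
begin

abbreviation sibs :: "ptree list" where
  "sibs \<equiv> map (subt T) (sibpos d v cs)"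

abbreviation bottom :: ptree where
  "bottom \<equiv> subt T (v @ cs)"

abbreviation with_sibs :: "ptree list \<Rightarrow> ptree" where
  "with_sibs xs \<equiv> repl T v (comb d cs xs bottom)"

lemma ispos: "ispos T v" "ispos (subt T v) cs" and dcat: "dcat d T" "dcat d (subt T v)"
  using tree path dcat_subt by (auto simp: is_path_iff_ispos ispos_append catalan_def)

lemma children_less: "\<forall>c\<in>set cs. c < d"
  using ispos_children_less ispos dcat by blast

lemma ispos_sibs: "\<forall>q\<in>set (sibpos d v cs). ispos T q"
  using ispos dcat ispos_sibpos by (subst sibpos_prefix) (auto simp: ispos_append)

lemma length_sibs: "length sibs = (d - 1) * length cs"
  using length_sibpos children_less by (subst sibpos_prefix) simp

lemma repl_all_conv_with_sibs:
  "length xs = (d - 1) * length cs \<Longrightarrow> repl_all T (zip (sibpos d v cs) xs) = with_sibs xs"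
  using ispos dcat by (subst sibpos_prefix) (simp add: repl_all_prefix repl_all_sibpos subt_append)

lemma with_sibs_sibs: "with_sibs sibs = T"
proof -
  have "repl_all T (zip P (map (subt T) P)) = T" if "set P \<subseteq> set (sibpos d v cs)" for P
    using that ispos_sibs by (induction P) (auto simp: repl_subt_self)
  then show ?thesis using repl_all_conv_with_sibs[OF length_sibs] by auto
qed

lemma shuffle_class_conv:
  "shuffle_class d T v cs = with_sibs ` permutations_of_multiset (mset sibs)"
proof -
  let ?P = "sibpos d v cs"
  have "repl_all T (map (\<lambda>m. (?P ! m, subt T (?P ! (\<sigma> m)))) [0..<length ?P])
    = with_sibs (permute_list \<sigma> sibs)" if \<sigma>: "\<sigma> permutes {..<length sibs}" for \<sigma>
  proof -
    have "map (\<lambda>m. (?P ! m, subt T (?P ! (\<sigma> m)))) [0..<length ?P] = zip ?P (permute_list \<sigma> sibs)"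
      using permutes_in_image[OF \<sigma>] by (intro nth_equalityI) (auto simp: permute_list_def)
    then show ?thesis using repl_all_conv_with_sibs length_sibs by simp
  qed
  then have "shuffle_class d T v cs
    = (\<lambda>\<sigma>. with_sibs (permute_list \<sigma> sibs)) ` {\<sigma>. \<sigma> permutes {..<length sibs}}"
    unfolding shuffle_class_def Let_def setcompr_eq_image by (intro image_cong) auto
  also have "\<dots> = with_sibs ` (\<lambda>\<sigma>. permute_list \<sigma> sibs) ` {\<sigma>. \<sigma> permutes {..<length sibs}}"
    by (simp only: image_image)
  finally show ?thesis unfolding image_permute_list .
qed

lemma inj_on_with_sibs: "inj_on with_sibs (permutations_of_multiset (mset sibs))"
proof (rule inj_onI)
  fix xs ys
  assume perm: "xs \<in> permutations_of_multiset (mset sibs)"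
    "ys \<in> permutations_of_multiset (mset sibs)"
    and "with_sibs xs = with_sibs ys"
  then have "comb d cs xs bottom = comb d cs ys bottom" using subt_repl[OF ispos(1)] by metis
  moreover have "length xs = (d - 1) * length cs" "length ys = (d - 1) * length cs"
    using perm length_sibs by (auto dest!: length_finite_permutations_of_multiset)
  ultimately show "xs = ys" using comb_inject children_less by blast
qed

lemma with_sibs_catalan:
  assumes "mset xs = mset sibs"
  shows "with_sibs xs \<in> catalan d k"
proof -
  have len: "length xs = (d - 1) * length cs" using assms length_sibs by (metis size_mset)
  have "sum_list (map internal xs) = sum_list (map internal sibs)"
    using assms by (metis mset_map sum_mset_sum_list)
  then have "internal (comb d cs xs bottom) = internal (comb d cs sibs bottom)"
    using internal_comb[OF len] internal_comb[OF length_sibs] by simp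
  also have "comb d cs sibs bottom = subt T v"
    using with_sibs_sibs subt_repl[OF ispos(1)] by metis
  finally have "internal (comb d cs xs bottom) = internal (subt T v)" .
  moreover have "\<forall>x\<in>set xs. dcat d x"
    using dcat_subt dcat(1) ispos_sibs mset_eq_setD[OF assms] by auto
  then have "dcat d (comb d cs xs bottom)"
    using dcat_comb children_less len dcat_subt dcat(1) path by (simp add: is_path_iff_ispos)
  ultimately show ?thesis
    using tree ispos dcat by (auto simp: catalan_def dcat_repl internal_repl)
qed

lemma shuffle_class_subset: "shuffle_class d T v cs \<subseteq> catalan d k"
  unfolding shuffle_class_conv using with_sibs_catalan by (auto dest: permutations_of_multisetD)

end

lemma shuffle_classesE:
  assumes "S \<in> shuffle_classes d k p"
  obtains T v cs where "S = shuffle_class d T v cs" "catalan_path d k T v cs" "length cs = p"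
  using assms by (auto simp: shuffle_classes_def catalan_path_def)

lemma shuffle_classes_subset: "S \<in> shuffle_classes d k p \<Longrightarrow> S \<subseteq> catalan d k"
  by (metis catalan_path.shuffle_class_subset shuffle_classesE)

fun left_comb :: "nat \<Rightarrow> nat \<Rightarrow> ptree" where
  "left_comb d 0 = Nd []"
| "left_comb d (Suc q) = Nd (left_comb d q # leaves (d - 1))"

lemma dcat_left_comb: "d \<ge> 1 \<Longrightarrow> dcat d (left_comb d q)"
  by (induction q) (auto simp: list_all_iff)

lemma ispos_left_comb: "ispos (left_comb d q) (replicate q 0)"
  by (induction q) auto

lemma subt_sibpos_left_comb:
  "d \<ge> 1 \<Longrightarrow> w \<in> set (sibpos d [] (replicate q 0)) \<Longrightarrow> subt (left_comb d q) w = Nd []"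
  by (induction q arbitrary: w) (auto simp: sibpos_Cons nth_Cons')

lemma permutations_of_multiset_replicate_mset [simp]:
  "permutations_of_multiset (replicate_mset m x) = {replicate m x}"
proof -
  have "xs = replicate m x" if "mset xs = replicate_mset m x" for xs
    using that by (metis in_replicate_mset replicate_length_same set_mset_mset size_mset
        size_replicate_mset)
  then show ?thesis by (auto simp: permutations_of_multiset_def)
qed

lemma singleton_shuffle_class:
  assumes "d \<ge> 1" "T \<in> catalan d k" "left_comb d p \<in> subtrees T"
  shows "{T} \<in> shuffle_classes d k p"
proof -
  let ?cs = "replicate p 0"
  obtain v where v: "ispos T v" "subt T v = left_comb d p"
    using assms(3) by (auto simp: subtrees_def)
  interpret catalan_path d k T v ?cs
    using assms v ispos_left_comb by unfold_locales (auto simp: is_path_iff_ispos ispos_append)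
  have "\<forall>x\<in>set sibs. x = Nd []"
    using v subt_sibpos_left_comb[OF assms(1)] by (subst sibpos_prefix) (auto simp: subt_append)
  then have sibs: "sibs = leaves (length sibs)" by (metis replicate_length_same)
  then have "permutations_of_multiset (mset sibs) = {sibs}"
    by (metis mset_replicate permutations_of_multiset_replicate_mset)
  then have "shuffle_class d T v ?cs = {T}"
    unfolding shuffle_class_conv using with_sibs_sibs by simp
  then show ?thesis
    unfolding shuffle_classes_def mem_Collect_eq
    using tree path length_replicate[of p "0 :: nat"] by metis
qed

section \<open>Tree weights\<close>

fun weight :: "'v set \<Rightarrow> ('v \<Rightarrow> 'v multiset \<Rightarrow> 'a) \<Rightarrow> ptree \<Rightarrow> 'v \<Rightarrow> ('v, 'a :: comm_ring_1) mps" where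
  "weight V c (Nd us) = (\<lambda>i. if us = [] then mps_X i
     else \<Sum>js\<in>tuples V (length us). mps_const (c i (mset js)) *
       (\<Prod>(j, w)\<leftarrow>zip js (map (weight V c) us). w j))"

declare weight.simps [simp del]

definition fweight ::
    "'v set \<Rightarrow> ('v \<Rightarrow> 'v multiset \<Rightarrow> 'a) \<Rightarrow> 'v list \<Rightarrow> ptree list \<Rightarrow> ('v, 'a :: comm_ring_1) mps" where
  "fweight V c js us = (\<Prod>(j, u)\<leftarrow>zip js us. weight V c u j)"

lemma weight_leaf [simp]: "weight V c (Nd []) i = mps_X i"
  by (simp add: weight.simps)

lemma weight_Nd:
  "us \<noteq> [] \<Longrightarrow> weight V c (Nd us) i
    = (\<Sum>js\<in>tuples V (length us). mps_const (c i (mset js)) * fweight V c js us)"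
  by (simp add: weight.simps fweight_def zip_map2 comp_def case_prod_beta')

lemma fweight_Nil [simp]: "fweight V c [] [] = 1"
  and fweight_Cons [simp]: "fweight V c (j # js) (u # us) = weight V c u j * fweight V c js us"
  by (simp_all add: fweight_def)

lemma fweight_append:
  "length js = length us \<Longrightarrow>
    fweight V c (js @ js') (us @ us') = fweight V c js us * fweight V c js' us'"
  by (simp add: fweight_def)

lemma fweight_insert_at:
  "length js = length us \<Longrightarrow>
    fweight V c (insert_at m j js) (insert_at m u us) = weight V c u j * fweight V c js us"
  by (simp add: fweight_def zip_insert_at prod_list_map_insert_at)

lemma fweight_leaves:
  "length js = m \<Longrightarrow> fweight V c js (leaves m) = (\<Prod>j\<leftarrow>js. mps_X j)"
  by (induction js arbitrary: m) auto

lemma homogeneous_fweight: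
  assumes "length js = length us"
    and "\<And>j u. j \<in> set js \<Longrightarrow> u \<in> set us \<Longrightarrow> homogeneous V (m * internal u + 1) (weight V c u j)"
  shows "homogeneous V (m * (\<Sum>u\<leftarrow>us. internal u) + length us) (fweight V c js us)"
  using assms
proof (induction js us rule: list_induct2)
  case (Cons j js u us)
  have "homogeneous V ((m * internal u + 1) + (m * (\<Sum>u\<leftarrow>us. internal u) + length us))
      (weight V c u j * fweight V c js us)"
    using Cons by (intro homogeneous_mult) auto
  then show ?case by (simp add: algebra_simps)
qed (simp add: homogeneous_1)

lemma homogeneous_weight:
  "dcat d T \<Longrightarrow> i \<in> V \<Longrightarrow> homogeneous V ((d - 1) * internal T + 1) (weight V c T i)"
proof (induction T arbitrary: i)
  case (Nd us)
  show ?case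
  proof (cases "us = []")
    case True
    then show ?thesis using Nd.prems by (simp add: homogeneous_X[simplified])
  next
    case False
    then have us: "length us = d" "\<forall>u\<in>set us. dcat d u" using dcat_NdD Nd.prems(1) by blast+
    have "homogeneous V ((d - 1) * (\<Sum>u\<leftarrow>us. internal u) + length us) (fweight V c js us)"
      if "js \<in> tuples V d" for js
      using that us Nd.IH by (intro homogeneous_fweight) (auto simp: tuples_def)
    moreover have "(d - 1) * (\<Sum>u\<leftarrow>us. internal u) + length us = (d - 1) * internal (Nd us) + 1"
      using us False by (cases d) auto
    ultimately show ?thesis
      unfolding weight_Nd[OF False] us(1) by (intro homogeneous_sum homogeneous_const_mult) simp
  qed
qed

lemma mcoeff_weight_eq_0:
  assumes "dcat d T" "i \<in> V" "A \<notin> msets V ((d - 1) * internal T + 1)"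
  shows "mcoeff (weight V c T i) A = 0"
  using homogeneous_weight[OF assms(1,2)] assms(3) unfolding homogeneous_def by blast

section \<open>The tree expansion of a compositional inverse\<close>

definition form_subst ::
    "'v set \<Rightarrow> nat \<Rightarrow> ('v \<Rightarrow> 'v multiset \<Rightarrow> 'a) \<Rightarrow> ('v \<Rightarrow> ('v, 'a :: comm_ring_1) mps) \<Rightarrow>
      'v \<Rightarrow> ('v, 'a) mps" where
  "form_subst V d c G i = (\<Sum>js\<in>tuples V d. mps_const (c i (mset js)) * (\<Prod>j\<leftarrow>js. G j))"

primrec picard ::
    "'v set \<Rightarrow> nat \<Rightarrow> ('v \<Rightarrow> 'v multiset \<Rightarrow> 'a) \<Rightarrow> nat \<Rightarrow> 'v \<Rightarrow> ('v, 'a :: comm_ring_1) mps" where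
  "picard V d c 0 = (\<lambda>i. 0)"
| "picard V d c (Suc h) = (\<lambda>i. mps_X i + form_subst V d c (picard V d c h) i)"

lemma picard_conv_trees:
  assumes "d \<ge> 1"
  shows "picard V d c h i = (\<Sum>T\<in>trees d h. weight V c T i)"
proof (induction h arbitrary: i)
  case (Suc h)
  have "form_subst V d c (picard V d c h) i
    = (\<Sum>js\<in>tuples V d. mps_const (c i (mset js)) * (\<Prod>j\<leftarrow>js. \<Sum>T\<in>trees d h. weight V c T j))"
    unfolding form_subst_def Suc ..
  also have "\<dots> = (\<Sum>js\<in>tuples V d. \<Sum>us\<in>tuples (trees d h) d.
      mps_const (c i (mset js)) * fweight V c js us)"
    by (intro sum.cong refl)
      (auto simp: prod_list_sum_conv_tuples fweight_def sum_distrib_left tuples_def)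
  also have "\<dots> = (\<Sum>us\<in>tuples (trees d h) d. \<Sum>js\<in>tuples V d.
      mps_const (c i (mset js)) * fweight V c js us)"
    by (rule sum.swap)
  also have "\<dots> = (\<Sum>us\<in>tuples (trees d h) d. weight V c (Nd us) i)"
  proof (rule sum.cong)
    fix us assume "us \<in> tuples (trees d h) d"
    then have "us \<noteq> []" "length us = d" using assms by (auto simp: tuples_def)
    then show "(\<Sum>js\<in>tuples V d. mps_const (c i (mset js)) * fweight V c js us)
      = weight V c (Nd us) i"
      by (simp add: weight_Nd)
  qed simp
  also have "\<dots> = (\<Sum>T\<in>Nd ` tuples (trees d h) d. weight V c T i)"
    by (subst sum.reindex) (auto simp: inj_on_def)
  finally have "picard V d c (Suc h) i
    = mps_X i + (\<Sum>T\<in>Nd ` tuples (trees d h) d. weight V c T i)" by simp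
  moreover have "Nd [] \<notin> Nd ` tuples (trees d h) d" using assms by (auto simp: tuples_def)
  ultimately show ?case by simp
qed simp

definition tree_series ::
    "'v set \<Rightarrow> nat \<Rightarrow> ('v \<Rightarrow> 'v multiset \<Rightarrow> 'a) \<Rightarrow> 'v \<Rightarrow> ('v, 'a :: comm_ring_1) mps" where
  "tree_series V d c i
    = Mps (\<lambda>A. \<Sum>T | dcat d T \<and> (d - 1) * internal T + 1 = size A. mcoeff (weight V c T i) A)"

lemma mcoeff_tree_series:
  "mcoeff (tree_series V d c i) A
    = (\<Sum>T | dcat d T \<and> (d - 1) * internal T + 1 = size A. mcoeff (weight V c T i) A)"
  by (simp add: tree_series_def Mps_inverse)

lemma mcoeff_tree_series_catalan:
  assumes "d \<ge> 2" "size A = (d - 1) * k + 1"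
  shows "mcoeff (tree_series V d c i) A = (\<Sum>T\<in>catalan d k. mcoeff (weight V c T i) A)"
proof -
  have "{T. dcat d T \<and> (d - 1) * internal T + 1 = size A} = catalan d k"
    using assms by (auto simp: catalan_def)
  then show ?thesis by (simp only: mcoeff_tree_series)
qed

lemma mcoeff_tree_series_eq_0:
  assumes "i \<in> V" "\<not> set_mset A \<subseteq> V"
  shows "mcoeff (tree_series V d c i) A = 0"
  unfolding mcoeff_tree_series
  using assms by (intro sum.neutral ballI mcoeff_weight_eq_0) (auto simp: msets_def)

lemma order_ge_tree_series_minus_picard:
  assumes "d \<ge> 2" "i \<in> V"
  shows "order_ge (Suc h) (tree_series V d c i - picard V d c h i)"
  unfolding order_ge_def
proof (intro allI impI)
  fix A :: "'a multiset" assume A: "size A < Suc h"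
  let ?N = "{T. dcat d T \<and> (d - 1) * internal T + 1 = size A}"
  have "?N \<subseteq> trees d h"
  proof
    fix T assume T: "T \<in> ?N"
    have "internal T \<le> (d - 1) * internal T" using assms(1) by (auto simp: Suc_le_eq)
    then have "internal T < h" using T A unfolding mem_Collect_eq by linarith
    then show "T \<in> trees d h" using T by (intro dcat_imp_mem_trees) auto
  qed
  moreover have "mcoeff (weight V c T i) A = 0" if "T \<in> trees d h - ?N" for T
    using that dcat_trees assms(2) by (intro mcoeff_weight_eq_0[of d]) (auto simp: msets_def)
  ultimately have "(\<Sum>T\<in>trees d h. mcoeff (weight V c T i) A) = (\<Sum>T\<in>?N. mcoeff (weight V c T i) A)"
    by (intro sum.mono_neutral_right) auto
  then show "mcoeff (tree_series V d c i - picard V d c h i) A = 0"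
    using assms(1) by (simp add: mcoeff_tree_series picard_conv_trees)
qed

lemma order_ge_prod_list_diff:
  assumes "\<And>j. j \<in> set js \<Longrightarrow> order_ge m (F j - G j) \<and> order_ge 1 (F j) \<and> order_ge 1 (G j)"
  shows "order_ge (m + (length js - 1)) ((\<Prod>j\<leftarrow>js. F j) - (\<Prod>j\<leftarrow>js. G j))"
  using assms
proof (induction js)
  case (Cons j js)
  have "order_ge (m + length (map F js)) ((F j - G j) * (\<Prod>j\<leftarrow>js. F j))"
    using Cons.prems by (intro order_ge_mult order_ge_prod_list) auto
  moreover have "order_ge (m + length js) (G j * ((\<Prod>j\<leftarrow>js. F j) - (\<Prod>j\<leftarrow>js. G j)))"
  proof (cases "js = []")
    case False
    have "order_ge (1 + (m + (length js - 1))) (G j * ((\<Prod>j\<leftarrow>js. F j) - (\<Prod>j\<leftarrow>js. G j)))"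
      using Cons by (intro order_ge_mult) auto
    then show ?thesis by (rule order_ge_mono) (use False in \<open>auto simp: Suc_le_eq\<close>)
  qed simp
  ultimately have "order_ge (m + length js)
      ((F j - G j) * (\<Prod>j\<leftarrow>js. F j) + G j * ((\<Prod>j\<leftarrow>js. F j) - (\<Prod>j\<leftarrow>js. G j)))"
    by (intro order_ge_add) auto
  then show ?case by (simp add: algebra_simps)
qed simp

lemma order_ge_form_subst_diff:
  assumes "d \<ge> 2" "\<And>j. j \<in> V \<Longrightarrow> order_ge m (F j - G j) \<and> order_ge 1 (F j) \<and> order_ge 1 (G j)"
  shows "order_ge (Suc m) (form_subst V d c F i - form_subst V d c G i)"
proof -
  have "order_ge (Suc m) ((\<Prod>j\<leftarrow>js. F j) - (\<Prod>j\<leftarrow>js. G j))" if js: "js \<in> tuples V d" for js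
  proof -
    have "order_ge (m + (length js - 1)) ((\<Prod>j\<leftarrow>js. F j) - (\<Prod>j\<leftarrow>js. G j))"
      using js assms(2) by (intro order_ge_prod_list_diff) (auto simp: tuples_def)
    then show ?thesis by (rule order_ge_mono) (use assms(1) js in \<open>auto simp: tuples_def\<close>)
  qed
  then show ?thesis
    unfolding form_subst_def sum_subtractf[symmetric] right_diff_distrib[symmetric]
    by (intro order_ge_sum order_ge_const_mult)
qed

lemma order_ge_form_subst:
  assumes "\<And>j. j \<in> V \<Longrightarrow> order_ge 1 (G j)"
  shows "order_ge d (form_subst V d c G i)"
  unfolding form_subst_def
proof (intro order_ge_sum order_ge_const_mult)
  fix js assume js: "js \<in> tuples V d"
  then have "order_ge (length (map G js)) (\<Prod>j\<leftarrow>js. G j)"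
    using assms by (intro order_ge_prod_list) (auto simp: tuples_def)
  then show "order_ge d (\<Prod>j\<leftarrow>js. G j)" using js by (simp add: tuples_def)
qed

lemma order_ge_picard:
  assumes "d \<ge> 1"
  shows "order_ge 1 (picard V d c h i)"
proof (induction h arbitrary: i)
  case (Suc h)
  have "order_ge d (form_subst V d c (picard V d c h) i)" using Suc by (rule order_ge_form_subst)
  then show ?case using assms by (auto intro: order_ge_add order_ge_X[simplified] order_ge_mono)
qed simp

lemma order_ge_fixpoint_minus_picard:
  assumes "d \<ge> 2" "\<And>i. i \<in> V \<Longrightarrow> order_ge 1 (G i)"
    "\<And>i. i \<in> V \<Longrightarrow> G i = mps_X i + form_subst V d c G i" "i \<in> V"
  shows "order_ge (Suc h) (G i - picard V d c h i)"
  using assms(4)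
proof (induction h arbitrary: i)
  case (Suc h)
  have "order_ge (Suc (Suc h)) (form_subst V d c G i - form_subst V d c (picard V d c h) i)"
    using assms Suc.IH order_ge_picard[of d V c h] by (intro order_ge_form_subst_diff) auto
  then show ?case by (subst assms(3)[OF Suc.prems]) simp
qed (use assms in simp)

lemma order_ge_tree_series:
  assumes "d \<ge> 2" "i \<in> V"
  shows "order_ge 1 (tree_series V d c i)"
  using order_ge_tree_series_minus_picard[OF assms, where h = 0] by simp

lemma tree_series_fixpoint:
  assumes "d \<ge> 2" "i \<in> V"
  shows "tree_series V d c i = mps_X i + form_subst V d c (tree_series V d c) i"
proof (rule mps_eqI_order)
  fix m
  let ?t = "tree_series V d c" and ?p = "picard V d c"
  have "order_ge m (?t j - ?p m j)" if "j \<in> V" for j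
    using order_ge_tree_series_minus_picard[OF assms(1) that] by (rule order_ge_mono) simp
  then have "order_ge (Suc m) (form_subst V d c ?t i - form_subst V d c (?p m) i)"
    using assms(1) order_ge_tree_series order_ge_picard[of d V c m]
    by (intro order_ge_form_subst_diff) auto
  moreover have "order_ge (Suc m) (?t i - ?p (Suc m) i)"
    using order_ge_tree_series_minus_picard[OF assms] by (rule order_ge_mono) simp
  ultimately have "order_ge (Suc m)
      (?t i - ?p (Suc m) i - (form_subst V d c ?t i - form_subst V d c (?p m) i))"
    by (rule order_ge_diff[rotated])
  then show "order_ge m (?t i - (mps_X i + form_subst V d c ?t i))"
    by (auto simp: algebra_simps elim: order_ge_mono)
qed

theorem fixpoint_iff_tree_series:
  assumes d: "d \<ge> 2"
  shows "(\<forall>i\<in>V. order_ge 1 (G i) \<and> G i = mps_X i + form_subst V d c G i)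
    \<longleftrightarrow> (\<forall>i\<in>V. G i = tree_series V d c i)" (is "?L \<longleftrightarrow> ?R")
proof
  assume fix_G: ?L
  show ?R
  proof
    fix i assume i: "i \<in> V"
    show "G i = tree_series V d c i"
    proof (rule mps_eqI_order)
      fix m
      have "order_ge (Suc m) (G i - picard V d c m i - (tree_series V d c i - picard V d c m i))"
        using fix_G i by (intro order_ge_diff order_ge_tree_series_minus_picard[OF d]
            order_ge_fixpoint_minus_picard[OF d]) blast+
      then show "order_ge m (G i - tree_series V d c i)" by (auto elim: order_ge_mono)
    qed
  qed
next
  assume eq: ?R
  have "form_subst V d c G i = form_subst V d c (tree_series V d c) i" for i
    unfolding form_subst_def using eq
    by (intro sum.cong refl arg_cong[where f = "\<lambda>x. _ * prod_list x"] map_cong)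
      (auto simp: tuples_def)
  then show ?L using eq order_ge_tree_series[OF d] tree_series_fixpoint[OF d] by metis
qed

section \<open>Majorants\<close>

definition dominated ::
    "('v, 'a :: {comm_ring_1, real_normed_algebra_1}) mps \<Rightarrow> ('v, real) mps \<Rightarrow> bool" where
  "dominated f g \<longleftrightarrow> (\<forall>A. norm (mcoeff f A) \<le> mcoeff g A)"

lemma dominated_1: "dominated 1 1"
  and dominated_X: "dominated (mps_X i) (mps_X i)"
  and dominated_const: "norm a \<le> r \<Longrightarrow> dominated (mps_const a) (mps_const r)"
  by (auto simp: dominated_def mcoeff_1 mcoeff_X mcoeff_const)

lemma dominated_sum: "(\<And>i. i \<in> I \<Longrightarrow> dominated (f i) (g i)) \<Longrightarrow> dominated (sum f I) (sum g I)"
  by (auto simp: dominated_def intro!: order_trans[OF norm_sum] sum_mono)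

lemma dominated_mult:
  assumes "dominated f g" "dominated f' g'"
  shows "dominated (f * f') (g * g')"
  unfolding dominated_def
proof
  fix A
  have "norm (mcoeff (f * f') A) \<le> (\<Sum>B | B \<subseteq># A. norm (mcoeff f B) * norm (mcoeff f' (A - B)))"
    unfolding mcoeff_mult by (rule order_trans[OF norm_sum sum_mono]) (rule norm_mult_ineq)
  also have "\<dots> \<le> (\<Sum>B | B \<subseteq># A. mcoeff g B * mcoeff g' (A - B))"
    using assms
    by (intro sum_mono mult_mono) (auto simp: dominated_def intro: order_trans[OF norm_ge_zero])
  finally show "norm (mcoeff (f * f') A) \<le> mcoeff (g * g') A" by (simp add: mcoeff_mult)
qed

lemma dominated_fweight:
  assumes "length js = length us"
    and "\<And>j u. j \<in> set js \<Longrightarrow> u \<in> set us \<Longrightarrow> dominated (weight V c u j) (weight V c' u j)"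
  shows "dominated (fweight V c js us) (fweight V c' js us)"
  using assms by (induction js us rule: list_induct2) (auto intro: dominated_1 dominated_mult)

lemma dominated_weight:
  assumes coeff_le: "\<And>i A. i \<in> V \<Longrightarrow> A \<in> msets V d \<Longrightarrow> norm (c i A) \<le> c' i A"
  shows "dcat d T \<Longrightarrow> i \<in> V \<Longrightarrow> dominated (weight V c T i) (weight V c' T i)"
proof (induction T arbitrary: i)
  case (Nd us)
  show ?case
  proof (cases "us = []")
    case False
    then have us: "length us = d" "\<forall>u\<in>set us. dcat d u" using dcat_NdD Nd.prems(1) by blast+
    have "dominated (mps_const (c i (mset js))) (mps_const (c' i (mset js)))"
      if "js \<in> tuples V d" for js
      using that Nd.prems(2) by (intro dominated_const coeff_le) (auto simp flip: mset_tuples)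
    moreover have "dominated (fweight V c js us) (fweight V c' js us)" if "js \<in> tuples V d" for js
      using that Nd.IH us by (intro dominated_fweight) (auto simp: tuples_def)
    ultimately show ?thesis
      unfolding weight_Nd[OF False] us(1) by (intro dominated_sum dominated_mult)
  qed (simp add: dominated_X)
qed

lemma weight_const_Nd:
  assumes "us \<noteq> []"
  shows "weight V (\<lambda>_ _. r) (Nd us) i = mps_const r * (\<Prod>u\<leftarrow>us. \<Sum>j\<in>V. weight V (\<lambda>_ _. r) u j)"
proof -
  have "fweight V (\<lambda>_ _. r) js us = (\<Prod>(u, j)\<leftarrow>zip us js. weight V (\<lambda>_ _. r) u j)" for js
    unfolding fweight_def by (subst zip_commute) (simp add: comp_def case_prod_beta')
  then show ?thesis
    by (simp add: weight_Nd[OF assms] prod_list_sum_conv_tuples sum_distrib_left)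
qed

lemma prod_list_const_power:
  "(\<Prod>u\<leftarrow>us. mps_const (q ^ internal u) * S ^ (m * internal u + 1))
    = mps_const (q ^ (\<Sum>u\<leftarrow>us. internal u)) * S ^ (m * (\<Sum>u\<leftarrow>us. internal u) + length us)"
  by (induction us) (simp_all add: power_add mps_const_mult mult_ac distrib_left)

lemma weight_const_Nd_power:
  fixes r :: "'a :: comm_ring_1" and V :: "'v set"
  defines "q \<equiv> of_nat (card V) * r" and "S \<equiv> \<Sum>j\<in>V. mps_X j :: ('v, 'a) mps"
  assumes us: "dcat d (Nd us)" "us \<noteq> []"
    and sum_children: "\<And>u. u \<in> set us \<Longrightarrow> dcat d u \<Longrightarrow>
      (\<Sum>j\<in>V. weight V (\<lambda>_ _. r) u j) = mps_const (q ^ internal u) * S ^ ((d - 1) * internal u + 1)"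
  shows "weight V (\<lambda>_ _. r) (Nd us) i
    = mps_const (r * q ^ (internal (Nd us) - 1)) * S ^ ((d - 1) * internal (Nd us) + 1)"
proof -
  have children: "length us = d" "\<forall>u\<in>set us. dcat d u" using dcat_NdD us by blast+
  then have "(\<Prod>u\<leftarrow>us. \<Sum>j\<in>V. weight V (\<lambda>_ _. r) u j)
    = (\<Prod>u\<leftarrow>us. mps_const (q ^ internal u) * S ^ ((d - 1) * internal u + 1))"
    using sum_children by (intro arg_cong[of _ _ prod_list] map_cong) auto
  also note prod_list_const_power
  also have "(d - 1) * (\<Sum>u\<leftarrow>us. internal u) + length us = (d - 1) * internal (Nd us) + 1"
    using children us(2) by (cases d) auto
  finally show ?thesis using us(2) by (simp add: weight_const_Nd mps_const_mult mult_ac)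
qed

lemma sum_weight_const:
  "dcat d T \<Longrightarrow> (\<Sum>i\<in>V. weight V (\<lambda>_ _. r) T i)
    = mps_const ((of_nat (card V) * r) ^ internal T) * (\<Sum>j\<in>V. mps_X j) ^ ((d - 1) * internal T + 1)"
proof (induction T)
  case (Nd us)
  show ?case
  proof (cases "us = []")
    case False
    then show ?thesis
      using weight_const_Nd_power[OF Nd.prems False Nd.IH]
      by (simp add: mps_const_mult mps_const_of_nat mult_ac)
  qed simp
qed

lemma weight_const:
  assumes "dcat d T" "T \<noteq> Nd []"
  shows "weight V (\<lambda>_ _. r) T i = mps_const (r * (of_nat (card V) * r) ^ (internal T - 1))
    * (\<Sum>j\<in>V. mps_X j) ^ ((d - 1) * internal T + 1)"
proof -
  obtain us where T: "T = Nd us" by (cases T)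
  then show ?thesis using weight_const_Nd_power[of d us V r i] sum_weight_const assms by blast
qed

lemma mcoeff_weight_const:
  assumes "finite V" "k \<ge> 1" "T \<in> catalan d k" "A \<in> msets V ((d - 1) * k + 1)"
  shows "mcoeff (weight V (\<lambda>_ _. r) T i) A
    = of_nat (card V) ^ (k - 1) * r ^ k * of_nat (multinomial A)"
proof -
  have "dcat d T" "internal T = k" "T \<noteq> Nd []" using assms(2,3) by (auto simp: catalan_def)
  then have "mcoeff (weight V (\<lambda>_ _. r) T i) A
    = r * (of_nat (card V) * r) ^ (k - 1) * of_nat (multinomial A)"
    using assms(4) weight_const[of d T V r i]
    by (simp add: mcoeff_sum_X_power[OF assms(1)] del: power_Suc)
  also have "r * (of_nat (card V) * r) ^ (k - 1) = of_nat (card V) ^ (k - 1) * r ^ k"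
    using assms(2) by (cases k) (simp_all add: power_mult_distrib mult_ac)
  finally show ?thesis .
qed

lemma norm_mcoeff_weight_le:
  fixes c :: "'v \<Rightarrow> 'v multiset \<Rightarrow> 'a :: {comm_ring_1, real_normed_algebra_1}"
  assumes "finite V" "k \<ge> 1" "T \<in> catalan d k" "i \<in> V" "A \<in> msets V ((d - 1) * k + 1)"
    and "\<And>i A. i \<in> V \<Longrightarrow> A \<in> msets V d \<Longrightarrow> norm (c i A) \<le> r"
  shows "norm (mcoeff (weight V c T i) A)
    \<le> real (card V) ^ (k - 1) * r ^ k * real (multinomial A)"
proof -
  have "dominated (weight V c T i) (weight V (\<lambda>_ _. r) T i)"
    using assms(3,4,6) by (intro dominated_weight) (auto simp: catalan_def)
  then have "norm (mcoeff (weight V c T i) A) \<le> mcoeff (weight V (\<lambda>_ _. r) T i) A"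
    by (simp add: dominated_def)
  also have "\<dots> = real (card V) ^ (k - 1) * r ^ k * real (multinomial A)"
    using assms(1-3,5) by (rule mcoeff_weight_const)
  finally show ?thesis .
qed

section \<open>Polarisation along a path\<close>

definition edge_weight ::
    "'v set \<Rightarrow> ('v \<Rightarrow> 'v multiset \<Rightarrow> 'a) \<Rightarrow> ptree list \<Rightarrow> 'v \<Rightarrow> 'v \<Rightarrow> ('v, 'a :: comm_ring_1) mps" where
  "edge_weight V c us l j
    = (\<Sum>a\<in>tuples V (length us). mps_const (c l (add_mset j (mset a))) * fweight V c a us)"

lemma edge_weight_leaves:
  "edge_weight V c (leaves m) l j
    = (\<Sum>a\<in>tuples V m. mps_const (c l (add_mset j (mset a))) * (\<Prod>i\<leftarrow>a. mps_X i))"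
  unfolding edge_weight_def length_replicate
  by (rule sum.cong) (simp_all add: tuples_def fweight_leaves)

lemma weight_insert_at:
  assumes "m \<le> length us"
  shows "weight V c (Nd (insert_at m T us)) l = (\<Sum>j\<in>V. edge_weight V c us l j * weight V c T j)"
proof -
  have "weight V c (Nd (insert_at m T us)) l
    = (\<Sum>j\<in>V. \<Sum>a\<in>tuples V (length us). mps_const (c l (mset (insert_at m j a))) *
        fweight V c (insert_at m j a) (insert_at m T us))"
    by (simp add: weight_Nd sum_tuples_insert_at[OF assms])
  also have "\<dots> = (\<Sum>j\<in>V. edge_weight V c us l j * weight V c T j)"
    unfolding edge_weight_def sum_distrib_right
    by (intro sum.cong refl) (auto simp: tuples_def fweight_insert_at mult_ac)
  finally show ?thesis .
qed

primrec path_coeff ::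
    "'v set \<Rightarrow> ('v \<Rightarrow> 'v multiset \<Rightarrow> 'a) \<Rightarrow> nat \<Rightarrow> nat \<Rightarrow> 'v \<Rightarrow> 'v \<Rightarrow> 'v list \<Rightarrow> 'a :: comm_ring_1" where
  "path_coeff V c d 0 l b a = (if l = b then 1 else 0)"
| "path_coeff V c d (Suc p) l b a = (\<Sum>j\<in>V. c l (add_mset j (mset (take (d - 1) a))) *
     path_coeff V c d p j b (drop (d - 1) a))"

definition path_weight ::
    "'v set \<Rightarrow> ('v \<Rightarrow> 'v multiset \<Rightarrow> 'a) \<Rightarrow> nat \<Rightarrow> nat \<Rightarrow> 'v \<Rightarrow> 'v \<Rightarrow> ptree list \<Rightarrow>
      ('v, 'a :: comm_ring_1) mps" where
  "path_weight V c d p l b us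
    = (\<Sum>a\<in>tuples V ((d - 1) * p). mps_const (path_coeff V c d p l b a) * fweight V c a us)"

lemma path_weight_leaves:
  "path_weight V c d p l b (leaves ((d - 1) * p))
    = (\<Sum>a\<in>tuples V ((d - 1) * p). mps_const (path_coeff V c d p l b a) * (\<Prod>j\<leftarrow>a. mps_X j))"
  unfolding path_weight_def by (rule sum.cong) (simp_all add: tuples_def fweight_leaves)

lemma path_weight_0 [simp]: "path_weight V c d 0 l b [] = (if l = b then 1 else 0)"
  by (simp add: path_weight_def)

lemma path_weight_Suc:
  assumes "length us = (d - 1) * Suc p"
  shows "path_weight V c d (Suc p) l b us
    = (\<Sum>j\<in>V. edge_weight V c (take (d - 1) us) l j * path_weight V c d p j b (drop (d - 1) us))"
proof -
  let ?ys = "take (d - 1) us" and ?zs = "drop (d - 1) us"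
  have len: "length ?ys = d - 1" using assms by simp
  let ?term = "\<lambda>j a a'. mps_const (c l (add_mset j (mset a)) * path_coeff V c d p j b a') *
    (fweight V c a ?ys * fweight V c a' ?zs)"
  have "path_weight V c d (Suc p) l b us
    = (\<Sum>a\<in>tuples V (d - 1). \<Sum>a'\<in>tuples V ((d - 1) * p).
        mps_const (path_coeff V c d (Suc p) l b (a @ a')) * fweight V c (a @ a') us)"
    unfolding path_weight_def mult_Suc_right sum_tuples_append ..
  also have "\<dots> = (\<Sum>a\<in>tuples V (d - 1). \<Sum>a'\<in>tuples V ((d - 1) * p). \<Sum>j\<in>V. ?term j a a')"
  proof (intro sum.cong refl)
    fix a a' assume "a \<in> tuples V (d - 1)"
    then have len_a: "length a = d - 1" by (simp add: tuples_def)
    then have "fweight V c (a @ a') us = fweight V c a ?ys * fweight V c a' ?zs"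
      using fweight_append[of a ?ys V c a' ?zs] len by simp
    then show "mps_const (path_coeff V c d (Suc p) l b (a @ a')) * fweight V c (a @ a') us
      = (\<Sum>j\<in>V. ?term j a a')"
      using len_a by (simp add: mps_const_sum sum_distrib_right)
  qed
  also have "\<dots> = (\<Sum>j\<in>V. \<Sum>a\<in>tuples V (d - 1). \<Sum>a'\<in>tuples V ((d - 1) * p). ?term j a a')"
    by (subst (2) sum.swap, subst sum.swap) (rule refl)
  also have "\<dots> = (\<Sum>j\<in>V. edge_weight V c ?ys l j * path_weight V c d p j b ?zs)"
    unfolding edge_weight_def path_weight_def sum_product len
    by (simp add: mps_const_mult mult_ac)
  finally show ?thesis .
qed

lemma weight_comb:
  assumes "finite V" "\<forall>m\<in>set cs. m < d" "length xs = (d - 1) * length cs" "l \<in> V"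
  shows "weight V c (comb d cs xs B) l
    = (\<Sum>b\<in>V. path_weight V c d (length cs) l b xs * weight V c B b)"
  using assms(2-)
proof (induction cs arbitrary: xs l)
  case Nil
  have "(\<Sum>b\<in>V. (if l = b then 1 else 0) * weight V c B b)
    = (\<Sum>b\<in>V. if l = b then weight V c B b else 0)"
    by (intro sum.cong) auto
  then show ?case using Nil assms(1) by simp
next
  case (Cons m cs)
  let ?ys = "take (d - 1) xs" and ?zs = "drop (d - 1) xs"
  have "weight V c (comb d (m # cs) xs B) l
    = (\<Sum>j\<in>V. edge_weight V c ?ys l j * weight V c (comb d cs ?zs B) j)"
    using Cons.prems unfolding comb.simps by (intro weight_insert_at) auto
  also have "\<dots> = (\<Sum>j\<in>V. \<Sum>b\<in>V.
      edge_weight V c ?ys l j * path_weight V c d (length cs) j b ?zs * weight V c B b)"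
    using Cons by (intro sum.cong refl) (simp add: sum_distrib_left mult.assoc)
  also have "\<dots> = (\<Sum>b\<in>V. \<Sum>j\<in>V.
      edge_weight V c ?ys l j * path_weight V c d (length cs) j b ?zs * weight V c B b)"
    by (rule sum.swap)
  also have "\<dots> = (\<Sum>b\<in>V. path_weight V c d (length (m # cs)) l b xs * weight V c B b)"
    using Cons.prems by (simp add: path_weight_Suc sum_distrib_right)
  finally show ?case .
qed

text \<open>Averaging over rearrangements makes the product depend only on the multiset of indices,
  so the coefficients enter only through their sums over rearrangements, which are the coefficients
  of the vanishing polynomial.\<close>

lemma sum_permutations_polarisation:
  fixes \<kappa> :: "'v list \<Rightarrow> 'a :: comm_ring_1" and f :: "'v \<Rightarrow> 'b \<Rightarrow> ('v, 'a) mps"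
  assumes V: "finite V" and zero: "(\<Sum>a\<in>tuples V r. mps_const (\<kappa> a) * (\<Prod>j\<leftarrow>a. mps_X j)) = 0"
    and M: "size M = r"
  shows "(\<Sum>a\<in>tuples V r. mps_const (\<kappa> a) *
    (\<Sum>xs\<in>permutations_of_multiset M. \<Prod>(j, x)\<leftarrow>zip a xs. f j x)) = 0"
proof -
  define F where "F a = (\<Sum>xs\<in>permutations_of_multiset M. \<Prod>(j, x)\<leftarrow>zip a xs. f j x)" for a
  have "(\<Sum>a\<in>permutations_of_multiset A. mps_const (\<kappa> a) * F a) = 0" if A: "A \<in> msets V r" for A
  proof -
    have "(\<Sum>a\<in>permutations_of_multiset A. \<kappa> a) = 0"
      using mcoeff_sum_tuples_X[OF V, of \<kappa> r A] zero permutations_conv_tuples[OF A] by simp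
    moreover obtain a0 where a0: "mset a0 = A" using ex_mset by blast
    have "F a = F a0" if "a \<in> permutations_of_multiset A" for a
      unfolding F_def using that a0 A M
      by (intro sum_permutations_prod_zip_cong) (auto simp: permutations_of_multiset_def msets_def)
    then have "(\<Sum>a\<in>permutations_of_multiset A. mps_const (\<kappa> a) * F a)
      = mps_const (\<Sum>a\<in>permutations_of_multiset A. \<kappa> a) * F a0"
      by (simp add: mps_const_sum sum_distrib_right)
    ultimately show ?thesis by simp
  qed
  then show ?thesis
    unfolding sum_tuples_conv_permutations[OF V] F_def by simp
qed

lemma sum_permutations_path_weight_eq_0:
  assumes "finite V" "path_weight V c d p l b (leaves ((d - 1) * p)) = 0"
    and "size M = (d - 1) * p"
  shows "(\<Sum>xs\<in>permutations_of_multiset M. path_weight V c d p l b xs) = 0"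
proof -
  have "(\<Sum>xs\<in>permutations_of_multiset M. path_weight V c d p l b xs)
    = (\<Sum>a\<in>tuples V ((d - 1) * p). \<Sum>xs\<in>permutations_of_multiset M.
        mps_const (path_coeff V c d p l b a) * fweight V c a xs)"
    unfolding path_weight_def by (rule sum.swap)
  also have "\<dots> = 0"
    unfolding sum_distrib_left[symmetric] fweight_def
    using assms(1) assms(2)[unfolded path_weight_leaves] assms(3)
    by (rule sum_permutations_polarisation)
  finally show ?thesis .
qed

definition leaf_paths_vanish ::
    "'v set \<Rightarrow> ('v \<Rightarrow> 'v multiset \<Rightarrow> 'a :: comm_ring_1) \<Rightarrow> nat \<Rightarrow> nat \<Rightarrow> bool" where
  "leaf_paths_vanish V c d p
    \<longleftrightarrow> (\<forall>l\<in>V. \<forall>b\<in>V. path_weight V c d p l b (leaves ((d - 1) * p)) = 0)"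

lemma sum_weight_comb_eq_0:
  assumes "finite V" "leaf_paths_vanish V c d (length cs)" "\<forall>m\<in>set cs. m < d"
    and "size M = (d - 1) * length cs" "l \<in> V"
  shows "(\<Sum>xs\<in>permutations_of_multiset M. weight V c (comb d cs xs B) l) = 0"
proof -
  let ?P = "permutations_of_multiset M"
  have "length xs = (d - 1) * length cs" if "xs \<in> ?P" for xs
    using that assms(4) by (metis length_finite_permutations_of_multiset)
  then have "(\<Sum>xs\<in>?P. weight V c (comb d cs xs B) l)
    = (\<Sum>xs\<in>?P. \<Sum>b\<in>V. path_weight V c d (length cs) l b xs * weight V c B b)"
    using assms by (intro sum.cong refl weight_comb) auto
  also have "\<dots> = (\<Sum>b\<in>V. (\<Sum>xs\<in>?P. path_weight V c d (length cs) l b xs) * weight V c B b)"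
    by (subst sum.swap) (simp add: sum_distrib_right)
  also have "\<dots> = 0"
    using assms by (simp add: sum_permutations_path_weight_eq_0 leaf_paths_vanish_def)
  finally show ?thesis .
qed

lemma sum_weight_repl_eq_0:
  assumes "\<And>l. l \<in> V \<Longrightarrow> (\<Sum>x\<in>I. weight V c (S x) l) = 0"
  shows "ispos T v \<Longrightarrow> i \<in> V \<Longrightarrow> (\<Sum>x\<in>I. weight V c (repl T v (S x)) i) = 0"
proof (induction T v arbitrary: i rule: ispos.induct)
  case (2 ts m v)
  then have m: "m < length ts" "ispos (ts ! m) v" by auto
  let ?us = "take m ts @ drop (Suc m) ts"
  have "weight V c (repl (Nd ts) (m # v) (S x)) i
    = (\<Sum>j\<in>V. edge_weight V c ?us i j * weight V c (repl (ts ! m) v (S x)) j)" for x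
    using m by (simp add: list_update_conv_insert_at weight_insert_at)
  then have "(\<Sum>x\<in>I. weight V c (repl (Nd ts) (m # v) (S x)) i)
    = (\<Sum>j\<in>V. edge_weight V c ?us i j * (\<Sum>x\<in>I. weight V c (repl (ts ! m) v (S x)) j))"
    by (simp only: sum_distrib_left) (rule sum.swap)
  then show ?case using 2 m by simp
qed (use assms in simp_all)

lemma sum_weight_shuffle_class_eq_0:
  assumes "finite V" "leaf_paths_vanish V c d p" "S \<in> shuffle_classes d k p" "i \<in> V"
  shows "(\<Sum>T\<in>S. weight V c T i) = 0"
  using assms(3)
proof (rule shuffle_classesE)
  fix T v cs assume S: "S = shuffle_class d T v cs" "catalan_path d k T v cs" "length cs = p"
  interpret catalan_path d k T v cs by (rule S(2))
  show ?thesis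
    unfolding S(1) shuffle_class_conv sum.reindex[OF inj_on_with_sibs] comp_def
    using assms S(3) children_less length_sibs
    by (intro sum_weight_repl_eq_0 ispos(1) sum_weight_comb_eq_0) auto
qed

lemma sum_shuffle_span_weight_eq_0:
  fixes c :: "'v \<Rightarrow> 'v multiset \<Rightarrow> 'a :: {comm_ring_1, real_algebra_1}"
  assumes "finite V" "leaf_paths_vanish V c d p" "\<phi> \<in> shuffle_span d k p" "i \<in> V"
  shows "(\<Sum>T\<in>catalan d k. of_real (\<phi> T) * mcoeff (weight V c T i) A) = 0"
proof -
  obtain F w where F: "F \<subseteq> shuffle_classes d k p" and \<phi>: "\<phi> = (\<lambda>T. \<Sum>S\<in>F. w S * indicator S T)"
    using assms(3) by (auto simp: shuffle_span_def)
  let ?g = "\<lambda>T. mcoeff (weight V c T i) A"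
  have "(\<Sum>T\<in>catalan d k. of_real (indicator S T) * ?g T) = 0" if "S \<in> F" for S
  proof -
    have S: "S \<in> shuffle_classes d k p" "S \<subseteq> catalan d k"
      using that F shuffle_classes_subset by blast+
    then have "(\<Sum>T\<in>catalan d k. of_real (indicator S T) * ?g T)
      = (\<Sum>T\<in>S. of_real (indicator S T) * ?g T)"
      by (intro sum.mono_neutral_right) (auto simp: indicator_def)
    also have "\<dots> = mcoeff (\<Sum>T\<in>S. weight V c T i) A" by (simp add: indicator_def)
    finally show ?thesis using sum_weight_shuffle_class_eq_0[OF assms(1,2) S(1) assms(4)] by simp
  qed
  moreover have "(\<Sum>T\<in>catalan d k. of_real (\<phi> T) * ?g T)
    = (\<Sum>S\<in>F. of_real (w S) * (\<Sum>T\<in>catalan d k. of_real (indicator S T) * ?g T))"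
    unfolding \<phi> of_real_sum of_real_mult sum_distrib_left sum_distrib_right
    by (subst sum.swap) (simp add: mult.assoc)
  ultimately show ?thesis by simp
qed

section \<open>Embedding coefficient functions into the ring of power series\<close>

lemma count_mem_mi_iff: "count A \<in> mi n \<longleftrightarrow> set_mset A \<subseteq> {..<n}"
proof -
  have "(\<forall>j\<ge>n. count A j = 0) \<longleftrightarrow> (\<forall>j. j \<in># A \<longrightarrow> j < n)"
    by (metis count_eq_zero_iff linorder_not_le)
  then show ?thesis by (auto simp: mi_def)
qed

lemma mi_imp_count:
  assumes "\<alpha> \<in> mi n"
  shows "\<exists>A. \<alpha> = count A \<and> set_mset A \<subseteq> {..<n}"
proof -
  have "{j. 0 < \<alpha> j} \<subseteq> {..<n}" using assms by (auto simp: mi_def not_less[symmetric])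
  then have "finite {j. 0 < \<alpha> j}" using finite_subset by blast
  then have "\<alpha> = count (Abs_multiset \<alpha>)" by simp
  then show ?thesis using assms count_mem_mi_iff by metis
qed

lemma mdeg_count: "set_mset A \<subseteq> {..<n} \<Longrightarrow> mdeg n (count A) = size A"
  unfolding mdeg_def size_multiset_overloaded_eq
  by (rule sum.mono_neutral_right) (auto simp: not_in_iff)

lemma mi_mdeg_conv_msets: "{\<beta> \<in> mi n. mdeg n \<beta> = r} = count ` msets {..<n} r"
proof (intro equalityI subsetI)
  fix \<beta> assume \<beta>: "\<beta> \<in> {\<beta> \<in> mi n. mdeg n \<beta> = r}"
  then obtain A where "\<beta> = count A" "set_mset A \<subseteq> {..<n}" using mi_imp_count by blast
  then show "\<beta> \<in> count ` msets {..<n} r" using \<beta> mdeg_count by (auto simp: msets_def)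
qed (auto simp: msets_def count_mem_mi_iff mdeg_count)

lemma mi_mdeg_msetsE:
  assumes "\<alpha> \<in> mi n" "mdeg n \<alpha> = r"
  obtains A where "A \<in> msets {..<n} r" "\<alpha> = count A"
  using assms mi_mdeg_conv_msets[of n r] by blast

lemma inj_count: "inj_on count S"
  by (simp add: inj_on_def count_inject)

lemma of_nat_multinomial_conv_mfact:
  assumes "A \<in> msets {..<n} r"
  shows "(of_nat (multinomial A) :: 'a :: field_char_0)
    = fact r / of_nat (mfact n (count A))"
proof -
  have "mfact n (count A) = (\<Prod>x\<in>set_mset A. fact (count A x))"
    unfolding mfact_def
    by (rule prod.mono_neutral_right) (use assms in \<open>auto simp: not_in_iff msets_def\<close>)
  then have "multinomial A * mfact n (count A) = fact r"
    using card_permutations_of_multiset_aux[of A] assms by (simp add: msets_def)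
  then have "of_nat (multinomial A) * of_nat (mfact n (count A)) = (fact r :: 'a)"
    by (metis of_nat_fact of_nat_mult)
  moreover have "of_nat (mfact n (count A)) \<noteq> (0 :: 'a)" by (simp add: mfact_def)
  ultimately show ?thesis by (simp add: eq_divide_eq)
qed

definition mps_of :: "nat \<Rightarrow> fps_n \<Rightarrow> (nat, complex) mps" where
  "mps_of n f = Mps (\<lambda>A. if set_mset A \<subseteq> {..<n} then f (count A) else 0)"

lemma mcoeff_mps_of: "mcoeff (mps_of n f) A = (if set_mset A \<subseteq> {..<n} then f (count A) else 0)"
  by (simp add: mps_of_def Mps_inverse)

lemma mps_of_eq_iff: "mps_of n f = mps_of n g \<longleftrightarrow> (\<forall>\<alpha>\<in>mi n. f \<alpha> = g \<alpha>)"
proof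
  assume eq: "mps_of n f = mps_of n g"
  show "\<forall>\<alpha>\<in>mi n. f \<alpha> = g \<alpha>"
  proof
    fix \<alpha> assume "\<alpha> \<in> mi n"
    then obtain A where "\<alpha> = count A" "set_mset A \<subseteq> {..<n}" using mi_imp_count by blast
    then show "f \<alpha> = g \<alpha>" using arg_cong[OF eq, of "\<lambda>f. mcoeff f A"] by (simp add: mcoeff_mps_of)
  qed
qed (auto intro!: mps_eqI simp: mcoeff_mps_of count_mem_mi_iff)

lemma ex_mps_of_eq:
  assumes "\<And>A. \<not> set_mset A \<subseteq> {..<n} \<Longrightarrow> mcoeff F A = 0"
  shows "\<exists>f. mps_of n f = F"
proof
  show "mps_of n (\<lambda>\<alpha>. mcoeff F (Abs_multiset \<alpha>)) = F"
    by (rule mps_eqI) (use assms in \<open>auto simp: mcoeff_mps_of count_inverse\<close>)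
qed

lemma below_count:
  assumes "set_mset A \<subseteq> {..<n}"
  shows "below n (count A) = count ` {B. B \<subseteq># A}"
proof (intro equalityI subsetI)
  fix \<beta> assume \<beta>: "\<beta> \<in> below n (count A)"
  then have "\<beta> \<in> mi n" by (simp add: below_def mi_def)
  then obtain B where "\<beta> = count B" using mi_imp_count by blast
  then show "\<beta> \<in> count ` {B. B \<subseteq># A}" using \<beta> by (auto simp: below_def subseteq_mset_def)
next
  fix \<beta> assume "\<beta> \<in> count ` {B. B \<subseteq># A}"
  then obtain B where B: "\<beta> = count B" "B \<subseteq># A" by blast
  then have "set_mset B \<subseteq> {..<n}" using assms set_mset_mono by blast
  then have "\<beta> \<in> mi n" using B count_mem_mi_iff by simp
  then show "\<beta> \<in> below n (count A)" using B by (simp add: below_def mi_def subseteq_mset_def)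
qed

lemma mps_of_smul: "mps_of n (smul n f g) = mps_of n f * mps_of n g"
proof (rule mps_eqI)
  fix A :: "nat multiset"
  have vars: "set_mset A = set_mset B \<union> set_mset (A - B)" if "B \<subseteq># A" for B
    using that by (metis set_mset_union subset_mset.add_diff_inverse)
  show "mcoeff (mps_of n (smul n f g)) A = mcoeff (mps_of n f * mps_of n g) A"
  proof (cases "set_mset A \<subseteq> {..<n}")
    case True
    have "count (A - B) = (\<lambda>j. count A j - count B j)" for B by (rule ext) simp
    then have "mcoeff (mps_of n (smul n f g)) A = (\<Sum>B | B \<subseteq># A. f (count B) * g (count (A - B)))"
      using True by (simp add: mcoeff_mps_of smul_def below_count sum.reindex[OF inj_count])
    also have "\<dots> = (\<Sum>B | B \<subseteq># A. mcoeff (mps_of n f) B * mcoeff (mps_of n g) (A - B))"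
      using True vars by (intro sum.cong) (auto simp: mcoeff_mps_of)
    finally show ?thesis by (simp add: mcoeff_mult)
  next
    case False
    then have "(\<Sum>B | B \<subseteq># A. mcoeff (mps_of n f) B * mcoeff (mps_of n g) (A - B)) = 0"
      using vars by (intro sum.neutral) (auto simp: mcoeff_mps_of)
    then show ?thesis using False by (simp add: mcoeff_mps_of[of n "smul n f g"] mcoeff_mult)
  qed
qed

lemma mps_of_sone: "mps_of n sone = 1"
proof (rule mps_eqI)
  fix A :: "nat multiset"
  have "count A = (\<lambda>_. 0) \<longleftrightarrow> A = {#}" by (auto simp: multiset_eq_iff)
  then show "mcoeff (mps_of n sone) A = mcoeff 1 A" by (auto simp: mcoeff_mps_of sone_def mcoeff_1)
qed

lemma mps_of_add: "mps_of n (\<lambda>\<alpha>. f \<alpha> + g \<alpha>) = mps_of n f + mps_of n g"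
  and mps_of_scale: "mps_of n (\<lambda>\<alpha>. a * f \<alpha>) = mps_const a * mps_of n f"
  and mps_of_zero: "mps_of n (\<lambda>\<alpha>. 0) = 0"
  and mps_of_sum: "mps_of n (\<lambda>\<alpha>. \<Sum>i\<in>I. h i \<alpha>) = (\<Sum>i\<in>I. mps_of n (h i))"
  by (rule mps_eqI; simp add: mcoeff_mps_of)+

lemma mps_of_unitv:
  assumes "i < n"
  shows "mps_of n (\<lambda>\<alpha>. if \<alpha> = unitv i then 1 else 0) = mps_X i"
proof (rule mps_eqI)
  fix A
  have "count A = unitv i \<longleftrightarrow> A = {#i#}" by (auto simp: multiset_eq_iff unitv_def fun_eq_iff)
  then show "mcoeff (mps_of n (\<lambda>\<alpha>. if \<alpha> = unitv i then 1 else 0)) A = mcoeff (mps_X i) A"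
    using assms by (auto simp: mcoeff_mps_of mcoeff_X)
qed

lemma mps_of_spow: "mps_of n (spow n f m) = mps_of n f ^ m"
  by (induction m) (simp_all add: spow_def mps_of_sone mps_of_smul)

lemma mps_of_smono: "mps_of n (smono n G \<beta>) = (\<Prod>j<n. mps_of n (G j) ^ \<beta> j)"
proof -
  have "mps_of n (foldr (\<lambda>j acc. smul n (spow n (G j) (\<beta> j)) acc) xs sone)
    = (\<Prod>j\<leftarrow>xs. mps_of n (G j) ^ \<beta> j)" for xs
    by (induction xs) (simp_all add: mps_of_sone mps_of_smul mps_of_spow)
  then show ?thesis
    by (simp add: smono_def prod.distinct_set_conv_list[symmetric] atLeast0LessThan)
qed

lemma mps_of_matmul: "mps_of n (matmul n X Y i j) = (\<Sum>l<n. mps_of n (X i l) * mps_of n (Y l j))"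
  by (simp add: matmul_def mps_of_sum mps_of_smul)

lemma mcoeff_mps_of_sderiv:
  assumes "j < n"
  shows "mcoeff (mps_of n (sderiv j f)) A
    = of_nat (count A j + 1) * mcoeff (mps_of n f) (add_mset j A)"
proof -
  have "(count A)(j := count A j + 1) = count (add_mset j A)" by auto
  then show ?thesis using assms unfolding mcoeff_mps_of sderiv_def by simp
qed

lemma prod_list_conv_count:
  fixes f :: "'b \<Rightarrow> 'a :: comm_monoid_mult"
  assumes "finite V" "set js \<subseteq> V"
  shows "(\<Prod>j\<leftarrow>js. f j) = (\<Prod>j\<in>V. f j ^ count (mset js) j)"
proof -
  have "(\<Prod>j\<leftarrow>js. f j) = (\<Prod>j\<in>set_mset (mset js). f j ^ count (mset js) j)"
    by (metis image_prod_mset_multiplicity mset_map prod_mset_prod_list)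
  also have "\<dots> = (\<Prod>j\<in>V. f j ^ count (mset js) j)"
  proof (rule prod.mono_neutral_left)
    show "\<forall>j\<in>V - set_mset (mset js). f j ^ count (mset js) j = 1"
      by (metis DiffD2 count_eq_zero_iff power_0)
  qed (use assms in auto)
  finally show ?thesis .
qed

text \<open>Summing over tuples instead of multi-indices counts \<open>X\<^sup>\<alpha>\<close> with multiplicity \<open>d!/\<alpha>!\<close>, which
  turns the coefficient \<open>H\<^sub>i\<^sub>,\<^sub>\<alpha>/\<alpha>!\<close> into \<open>H\<^sub>i\<^sub>,\<^sub>\<alpha>/d!\<close>.\<close>

definition tensor ::
    "nat \<Rightarrow> (nat \<Rightarrow> (nat \<Rightarrow> nat) \<Rightarrow> complex) \<Rightarrow> nat \<Rightarrow> nat multiset \<Rightarrow> complex" where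
  "tensor d Hc i A = Hc i (count A) / fact d"

lemma coeff_div_mfact_conv_tensor:
  assumes "A \<in> msets {..<n} d"
  shows "Hc i (count A) / of_nat (mfact n (count A))
    = of_nat (multinomial A) * tensor d Hc i A"
  by (simp add: of_nat_multinomial_conv_mfact[OF assms] tensor_def)

lemma mps_of_Hcomp:
  "mps_of n (Hcomp n d Hc g i) = form_subst {..<n} d (tensor d Hc) (\<lambda>j. mps_of n (g j)) i"
proof -
  let ?P = "\<lambda>A. \<Prod>j<n. mps_of n (g j) ^ count A j"
  have "form_subst {..<n} d (tensor d Hc) (\<lambda>j. mps_of n (g j)) i
    = (\<Sum>js\<in>tuples {..<n} d. mps_const (tensor d Hc i (mset js)) * ?P (mset js))"
    unfolding form_subst_def
    by (intro sum.cong) (auto simp: tuples_def prod_list_conv_count[of "{..<n}"])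
  also have "\<dots> = (\<Sum>A\<in>msets {..<n} d.
      mps_const (of_nat (multinomial A) * tensor d Hc i A) * ?P A)"
    by (subst sum_tuples_mset) (simp_all add: mps_const_mult mps_const_of_nat mult.assoc)
  also have "\<dots> = (\<Sum>A\<in>msets {..<n} d.
      mps_const (Hc i (count A) / of_nat (mfact n (count A))) * ?P A)"
    by (intro sum.cong) (simp_all add: coeff_div_mfact_conv_tensor)
  also have "\<dots> = mps_of n (Hcomp n d Hc g i)"
    unfolding Hcomp_def mi_mdeg_conv_msets
    by (simp only: mps_of_sum mps_of_scale mps_of_smono sum.reindex[OF inj_count] comp_def)
  finally show ?thesis by simp
qed

lemma is_inverse_iff_tree_series:
  assumes "d \<ge> 2"
  shows "is_inverse n d Hc g \<longleftrightarrow> (\<forall>i<n. mps_of n (g i) = tree_series {..<n} d (tensor d Hc) i)"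
proof -
  let ?G = "\<lambda>j. mps_of n (g j)"
  have "order_ge 1 (mps_of n f) \<longleftrightarrow> f (\<lambda>_. 0) = 0" for f
  proof -
    have count_empty: "count {#} = (\<lambda>_. 0 :: nat)" by (rule ext) simp
    show ?thesis by (auto simp: order_ge_def mcoeff_mps_of count_empty)
  qed
  moreover have "(\<forall>\<alpha>\<in>mi n. g i \<alpha> - Hcomp n d Hc g i \<alpha> = (if \<alpha> = unitv i then 1 else 0))
    \<longleftrightarrow> ?G i = mps_X i + form_subst {..<n} d (tensor d Hc) ?G i" if "i < n" for i
  proof -
    have "mps_X i + form_subst {..<n} d (tensor d Hc) ?G i
      = mps_of n (\<lambda>\<alpha>. (if \<alpha> = unitv i then 1 else 0) + Hcomp n d Hc g i \<alpha>)"
      unfolding mps_of_add mps_of_Hcomp using mps_of_unitv[OF that] by simp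
    then show ?thesis by (simp add: mps_of_eq_iff diff_eq_eq)
  qed
  ultimately have "is_inverse n d Hc g \<longleftrightarrow> (\<forall>i\<in>{..<n}. order_ge 1 (?G i)
      \<and> ?G i = mps_X i + form_subst {..<n} d (tensor d Hc) ?G i)"
    by (auto simp: is_inverse_def)
  then show ?thesis unfolding fixpoint_iff_tree_series[OF assms] by auto
qed

lemma ex_inverse:
  assumes "d \<ge> 2"
  shows "\<exists>g. is_inverse n d Hc g"
proof -
  have "\<exists>f. mps_of n f = tree_series {..<n} d (tensor d Hc) i" if "i < n" for i
    using that by (intro ex_mps_of_eq mcoeff_tree_series_eq_0) auto
  then obtain g where "\<forall>i<n. mps_of n (g i) = tree_series {..<n} d (tensor d Hc) i" by metis
  then show ?thesis using is_inverse_iff_tree_series[OF assms] by blast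
qed

lemma inverse_conv_catalan:
  assumes "d \<ge> 2" "is_inverse n d Hc g" "i < n" "A \<in> msets {..<n} ((d - 1) * k + 1)"
  shows "g i (count A) = (\<Sum>T\<in>catalan d k. mcoeff (weight {..<n} (tensor d Hc) T i) A)"
proof -
  have "set_mset A \<subseteq> {..<n}" "size A = (d - 1) * k + 1" using assms(4) by (simp_all add: msets_def)
  moreover have "mps_of n (g i) = tree_series {..<n} d (tensor d Hc) i"
    using assms(1-3) is_inverse_iff_tree_series by blast
  ultimately show ?thesis
    using mcoeff_tree_series_catalan[OF assms(1)] by (metis mcoeff_mps_of)
qed

section \<open>The Jacobian matrix\<close>

lemma mcoeff_mps_of_Hpoly:
  "mcoeff (mps_of n (Hpoly n d Hc i)) A
    = (if A \<in> msets {..<n} d then of_nat (multinomial A) * tensor d Hc i A else 0)"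
  using coeff_div_mfact_conv_tensor[of A n d Hc i]
  by (auto simp: mcoeff_mps_of Hpoly_def msets_def count_mem_mi_iff mdeg_count)

lemma mps_of_JH:
  assumes "d \<ge> 1" "j < n"
  shows "mps_of n (JH n d Hc i j)
    = mps_const (of_nat d) * edge_weight {..<n} (tensor d Hc) (leaves (d - 1)) i j"
proof (rule mps_eqI)
  fix A
  let ?t = "tensor d Hc i (add_mset j A)" and ?B = "add_mset j A"
  have mem: "?B \<in> msets {..<n} d \<longleftrightarrow> A \<in> msets {..<n} (d - 1)"
    using assms by (auto simp: msets_def)
  have "multinomial ?B * count ?B j = size ?B * multinomial (?B - {#j#})"
    by (rule card_permutations_of_multiset_remove_aux) simp
  then have "(count A j + 1) * multinomial ?B = Suc (size A) * multinomial A"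
    by (simp add: mult.commute)
  then have card: "of_nat (count A j + 1) * of_nat (multinomial ?B)
    = (of_nat d * of_nat (multinomial A) :: complex)" if "A \<in> msets {..<n} (d - 1)"
    using that assms by (simp only: msets_def mem_Collect_eq flip: of_nat_mult) simp
  have "mcoeff (mps_of n (JH n d Hc i j)) A = (if A \<in> msets {..<n} (d - 1)
      then of_nat (count A j + 1) * of_nat (multinomial ?B) * ?t else 0)"
    unfolding JH_def mcoeff_mps_of_sderiv[OF assms(2)] mcoeff_mps_of_Hpoly mem
    by (simp add: mult.assoc)
  also have "\<dots> = of_nat d * (if A \<in> msets {..<n} (d - 1)
      then of_nat (multinomial A) * ?t else 0)"
    using card by (simp only: mult.assoc if_distrib[of "(*) _"] mult_zero_right cong: if_cong)
  also have "\<dots> = mcoeff (mps_const (of_nat d) *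
      edge_weight {..<n} (tensor d Hc) (leaves (d - 1)) i j) A"
    unfolding edge_weight_leaves mcoeff_const_mult
    by (subst mcoeff_symmetric_sum_tuples_X[where \<kappa> = "\<lambda>A. tensor d Hc i (add_mset j A)"]) simp_all
  finally show "mcoeff (mps_of n (JH n d Hc i j)) A = mcoeff (mps_const (of_nat d) *
      edge_weight {..<n} (tensor d Hc) (leaves (d - 1)) i j) A" .
qed

lemma mps_of_matpow_JH:
  assumes "d \<ge> 1" "l < n"
  shows "mps_of n (matpow n (JH n d Hc) p l b) = mps_const (of_nat d ^ p) *
    path_weight {..<n} (tensor d Hc) d p l b (leaves ((d - 1) * p))"
  using assms(2)
proof (induction p arbitrary: l)
  case 0
  then show ?case by (simp add: matpow_def matid_def mps_of_sone mps_of_zero)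
next
  case (Suc p)
  let ?e = "edge_weight {..<n} (tensor d Hc) (leaves (d - 1))"
    and ?w = "\<lambda>j. path_weight {..<n} (tensor d Hc) d p j b (leaves ((d - 1) * p))"
  have "mps_of n (matpow n (JH n d Hc) (Suc p) l b)
    = (\<Sum>j<n. mps_of n (JH n d Hc l j) * mps_of n (matpow n (JH n d Hc) p j b))"
    by (simp add: matpow_def mps_of_matmul)
  also have "\<dots> = (\<Sum>j<n. mps_const (of_nat d ^ Suc p) * (?e l j * ?w j))"
  proof (intro sum.cong refl)
    fix j assume "j \<in> {..<n}"
    then have "j < n" by simp
    show "mps_of n (JH n d Hc l j) * mps_of n (matpow n (JH n d Hc) p j b)
      = mps_const (of_nat d ^ Suc p) * (?e l j * ?w j)"
      unfolding mps_of_JH[OF assms(1) \<open>j < n\<close>] Suc.IH[OF \<open>j < n\<close>] power_Suc mps_const_mult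
      by (simp only: mult_ac)
  qed
  also have "(\<Sum>j<n. mps_const (of_nat d ^ Suc p) * (?e l j * ?w j))
    = mps_const (of_nat d ^ Suc p) *
      path_weight {..<n} (tensor d Hc) d (Suc p) l b (leaves ((d - 1) * Suc p))"
    by (subst path_weight_Suc) (simp_all add: sum_distrib_left)
  finally show ?case .
qed

lemma JH_nilp_imp_leaf_paths_vanish:
  assumes "d \<ge> 1" "JH_nilp n d Hc p"
  shows "leaf_paths_vanish {..<n} (tensor d Hc) d p"
  unfolding leaf_paths_vanish_def
proof (intro ballI mps_eqI)
  fix l b A assume "l \<in> {..<n}" "b \<in> {..<n}"
  then have "mps_of n (matpow n (JH n d Hc) p l b) = mps_of n (\<lambda>_. 0)"
    using assms(2) by (simp add: mps_of_eq_iff JH_nilp_def)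
  then have "mps_const (of_nat d ^ p) *
      path_weight {..<n} (tensor d Hc) d p l b (leaves ((d - 1) * p)) = 0"
    using mps_of_matpow_JH[OF assms(1)] \<open>l \<in> {..<n}\<close> by (metis lessThan_iff mps_of_zero)
  then have "of_nat d ^ p *
      mcoeff (path_weight {..<n} (tensor d Hc) d p l b (leaves ((d - 1) * p))) A = 0"
    by (metis mcoeff_0 mcoeff_const_mult)
  then show "mcoeff (path_weight {..<n} (tensor d Hc) d p l b (leaves ((d - 1) * p))) A
    = mcoeff 0 A"
    using assms(1) by simp
qed

section \<open>The bounds\<close>

lemma Lmax_altdef:
  "Lmax n d Hc = Max ((\<lambda>(i, A). cmod (Hc i (count A))) ` ({..<n} \<times> msets {..<n} d))"
proof -
  have "{cmod (Hc i \<beta>) | i \<beta>. i < n \<and> \<beta> \<in> mi n \<and> mdeg n \<beta> = d}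
    = (\<lambda>(i, \<beta>). cmod (Hc i \<beta>)) ` ({..<n} \<times> {\<beta> \<in> mi n. mdeg n \<beta> = d})"
    by (auto simp: image_iff)
  also have "\<dots> = (\<lambda>(i, A). cmod (Hc i (count A))) ` ({..<n} \<times> msets {..<n} d)"
    unfolding mi_mdeg_conv_msets by (auto simp: image_iff)
  finally show ?thesis unfolding Lmax_def by (rule arg_cong)
qed

lemma norm_tensor_le:
  assumes "i < n" "A \<in> msets {..<n} d"
  shows "norm (tensor d Hc i A) \<le> Lmax n d Hc / fact d"
proof -
  have "cmod (Hc i (count A)) \<le> Lmax n d Hc"
    unfolding Lmax_altdef by (intro Max_ge) (use assms in auto)
  then show ?thesis by (simp add: tensor_def norm_divide divide_right_mono)
qed

lemma gbound_conv_card: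
  assumes "d \<ge> 1" "A \<in> msets {..<n} ((d - 1) * k + 1)"
  shows "gbound d n k (count A) L = real (card (catalan d k)) *
    (real n ^ (k - 1) * (L / fact d) ^ k * real (multinomial A))"
proof -
  have "mdeg n (count A) = (d - 1) * k + 1" using assms(2) mdeg_count by (auto simp: msets_def)
  moreover have "real (d * k choose k) = real ((d - 1) * k + 1) * real (card (catalan d k))"
    using card_catalan[OF assms(1), of k] by (metis of_nat_mult)
  moreover have "real ((d - 1) * k + 1) \<noteq> 0" by (simp only: of_nat_eq_0_iff)
  ultimately show ?thesis
    unfolding gbound_def of_nat_multinomial_conv_mfact[OF assms(2)]
    by (simp add: power_divide)
qed

lemma norm_weighted_tree_sum_le:
  fixes \<psi> :: "ptree \<Rightarrow> real"
  assumes "d \<ge> 1" "k \<ge> 1" "i < n" "A \<in> msets {..<n} ((d - 1) * k + 1)"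
  shows "norm (\<Sum>T\<in>catalan d k. of_real (\<psi> T) * mcoeff (weight {..<n} (tensor d Hc) T i) A)
    \<le> gbound d n k (count A) (Lmax n d Hc) * norm1 d k \<psi>"
proof -
  let ?w = "\<lambda>T. mcoeff (weight {..<n} (tensor d Hc) T i) A"
  let ?b = "real n ^ (k - 1) * (Lmax n d Hc / fact d) ^ k * real (multinomial A)"
  have "norm (?w T) \<le> ?b" if "T \<in> catalan d k" for T
    using norm_mcoeff_weight_le[of "{..<n}" k T d i A "tensor d Hc"] norm_tensor_le that assms
    by simp
  then have "norm (\<Sum>T\<in>catalan d k. of_real (\<psi> T) * ?w T) \<le> (\<Sum>T\<in>catalan d k. \<bar>\<psi> T\<bar> * ?b)"
    by (intro sum_norm_le) (simp add: norm_mult mult_left_mono)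
  also have "\<dots> = (\<Sum>T\<in>catalan d k. \<bar>\<psi> T\<bar>) * ?b" by (simp only: sum_distrib_right)
  also have "\<dots> = gbound d n k (count A) (Lmax n d Hc) * norm1 d k \<psi>"
    unfolding gbound_conv_card[OF assms(1,4)] norm1_def
    using card_catalan_pos[OF assms(1), of k] by simp
  finally show ?thesis .
qed

lemma norm_inverse_le:
  assumes "d \<ge> 2" "is_inverse n d Hc g" "i < n" "k \<ge> 1" "\<alpha> \<in> mi n" "mdeg n \<alpha> = (d - 1) * k + 1"
  shows "cmod (g i \<alpha>) \<le> gbound d n k \<alpha> (Lmax n d Hc)"
proof -
  obtain A where A: "A \<in> msets {..<n} ((d - 1) * k + 1)" "\<alpha> = count A"
    using assms(5,6) by (rule mi_mdeg_msetsE)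
  have "g i \<alpha> = (\<Sum>T\<in>catalan d k. of_real 1 * mcoeff (weight {..<n} (tensor d Hc) T i) A)"
    using inverse_conv_catalan[OF assms(1-3) A(1)] A(2) by simp
  also have "norm \<dots> \<le> gbound d n k (count A) (Lmax n d Hc) * norm1 d k (\<lambda>_. 1)"
    using assms A(1) by (intro norm_weighted_tree_sum_le) auto
  also have "norm1 d k (\<lambda>_. 1) = 1"
    using card_catalan_pos[of d k] assms(1) by (auto simp: norm1_def)
  finally show ?thesis using A(2) by simp
qed

lemma norm_inverse_nilpotent_le:
  assumes "d \<ge> 2" "is_inverse n d Hc g" "JH_nilp n d Hc p" "i < n" "k \<ge> 1" "\<alpha> \<in> mi n"
    "mdeg n \<alpha> = (d - 1) * k + 1" "\<phi> \<in> shuffle_span d k p"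
  shows "cmod (g i \<alpha>) \<le> gbound d n k \<alpha> (Lmax n d Hc) * norm1 d k (\<lambda>T. \<phi> T - 1)"
proof -
  obtain A where A: "A \<in> msets {..<n} ((d - 1) * k + 1)" "\<alpha> = count A"
    using assms(6,7) by (rule mi_mdeg_msetsE)
  let ?w = "\<lambda>T. mcoeff (weight {..<n} (tensor d Hc) T i) A"
  have "(\<Sum>T\<in>catalan d k. of_real (\<phi> T) * ?w T) = 0"
    using assms by (intro sum_shuffle_span_weight_eq_0 JH_nilp_imp_leaf_paths_vanish) auto
  moreover have "(\<Sum>T\<in>catalan d k. ?w T) = g i \<alpha>"
    using inverse_conv_catalan[OF assms(1,2,4) A(1)] A(2) by simp
  ultimately have "(\<Sum>T\<in>catalan d k. of_real (\<phi> T - 1) * ?w T) = - g i \<alpha>"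
    by (simp add: sum_subtractf left_diff_distrib)
  moreover have "norm (\<Sum>T\<in>catalan d k. of_real (\<phi> T - 1) * ?w T)
    \<le> gbound d n k (count A) (Lmax n d Hc) * norm1 d k (\<lambda>T. \<phi> T - 1)"
    using assms A(1) by (intro norm_weighted_tree_sum_le) auto
  ultimately show ?thesis using A(2) by simp
qed

lemma Lmax_one:
  assumes "n \<ge> 1"
  shows "Lmax n d (\<lambda>_ _. 1) = 1"
proof -
  have "replicate_mset d 0 \<in> msets {..<n} d"
    using assms by (auto simp: msets_def in_replicate_mset)
  then have "{..<n} \<times> msets {..<n} d \<noteq> {}" using assms by (auto simp: lessThan_empty_iff)
  then show ?thesis unfolding Lmax_altdef by (simp add: case_prod_beta')
qed

lemma norm_inverse_all_ones:
  assumes "d \<ge> 2" "is_inverse n d (\<lambda>_ _. 1) g" "i < n" "k \<ge> 1" "\<alpha> \<in> mi n"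
    "mdeg n \<alpha> = (d - 1) * k + 1"
  shows "cmod (g i \<alpha>) = gbound d n k \<alpha> 1"
proof -
  obtain A where A: "A \<in> msets {..<n} ((d - 1) * k + 1)" "\<alpha> = count A"
    using assms(5,6) by (rule mi_mdeg_msetsE)
  let ?b = "real n ^ (k - 1) * (1 / fact d) ^ k * real (multinomial A)"
  have tensor: "tensor d (\<lambda>_ _. 1) = (\<lambda>_ _. 1 / fact d)" by (intro ext) (simp add: tensor_def)
  have "mcoeff (weight {..<n} (tensor d (\<lambda>_ _. 1)) T i) A = of_real ?b" if "T \<in> catalan d k" for T
    unfolding tensor using mcoeff_weight_const[of "{..<n}" k T d A] that assms A(1) by simp
  then have "g i \<alpha> = (\<Sum>T\<in>catalan d k. of_real ?b)"
    using inverse_conv_catalan[OF assms(1-3) A(1)] A(2) by simp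
  also have "\<dots> = of_real (real (card (catalan d k)) * ?b)" by simp
  also have "real (card (catalan d k)) * ?b = gbound d n k \<alpha> 1"
    using gbound_conv_card[OF _ A(1), of 1] assms(1) A(2) by simp
  finally have "cmod (g i \<alpha>) = \<bar>gbound d n k \<alpha> 1\<bar>" by (simp only: norm_of_real)
  then show ?thesis by (simp add: gbound_def)
qed

lemma ex_inverse_attaining_gbound:
  assumes "d \<ge> 2" "n \<ge> 1"
  shows "\<exists>Hc g. is_inverse n d Hc g \<and> Lmax n d Hc > 0 \<and>
      (\<forall>i<n. \<forall>k\<ge>1. \<forall>\<alpha>\<in>mi n. mdeg n \<alpha> = (d - 1) * k + 1 \<longrightarrow>
         cmod (g i \<alpha>) = gbound d n k \<alpha> (Lmax n d Hc))"
proof -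
  obtain g where "is_inverse n d (\<lambda>_ _. 1) g" using ex_inverse[OF assms(1)] by blast
  then show ?thesis
    using norm_inverse_all_ones[OF assms(1)] Lmax_one[OF assms(2)]
    by (intro exI[of _ "\<lambda>_ _. 1"] exI[of _ g]) simp
qed

lemma indicator_left_comb_mem_shuffle_span:
  assumes "d \<ge> 1"
  shows "indicator {T \<in> catalan d k. left_comb d p \<in> subtrees T} \<in> shuffle_span d k p"
proof -
  define M where "M = {T \<in> catalan d k. left_comb d p \<in> subtrees T}"
  have "finite M" by (simp add: M_def)
  have "(\<Sum>S\<in>(\<lambda>T. {T}) ` M. 1 * indicator S T) = (indicator M T :: real)" for T
  proof -
    have "(\<Sum>S\<in>(\<lambda>T. {T}) ` M. 1 * indicator S T) = (\<Sum>T'\<in>M. if T' = T then 1 else 0 :: real)"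
      by (subst sum.reindex) (auto simp: inj_on_def indicator_def intro!: sum.cong)
    then show ?thesis using \<open>finite M\<close> by (simp add: indicator_def)
  qed
  then have "indicator M = (\<lambda>T. \<Sum>S\<in>(\<lambda>T. {T}) ` M. 1 * indicator S T :: real)" by auto
  moreover have "(\<lambda>T. {T}) ` M \<subseteq> shuffle_classes d k p"
    using singleton_shuffle_class[OF assms] by (auto simp: M_def)
  ultimately show ?thesis
    unfolding shuffle_span_def M_def[symmetric] mem_Collect_eq using \<open>finite M\<close>
    by (intro exI[of _ "(\<lambda>T. {T}) ` M"] exI[of _ "\<lambda>_. 1"]) simp
qed

lemma norm1_indicator_minus_one:
  "norm1 d k (\<lambda>T. indicator {T \<in> catalan d k. P T} T - 1)
    = real (card {T \<in> catalan d k. \<not> P T}) / real (card (catalan d k))"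
proof -
  have "(\<Sum>T\<in>catalan d k. \<bar>indicator {T \<in> catalan d k. P T} T - 1 :: real\<bar>)
    = (\<Sum>T\<in>catalan d k. if \<not> P T then 1 else 0)"
    by (intro sum.cong) (auto simp: indicator_def)
  also have "\<dots> = real (card {T \<in> catalan d k. \<not> P T})"
    by (simp flip: sum.inter_filter)
  finally show ?thesis by (simp add: norm1_def)
qed

lemma norm_inverse_nilpotent_exp_le:
  assumes "d \<ge> 2"
  shows "\<exists>C c. C > 0 \<and> c > 0 \<and> (\<exists>K. \<forall>k\<ge>K.
      \<forall>n\<ge>1. \<forall>Hc g. is_inverse n d Hc g \<and> JH_nilp n d Hc p \<longrightarrow>
        (\<forall>i<n. \<forall>\<alpha>\<in>mi n. mdeg n \<alpha> = (d - 1) * k + 1 \<longrightarrow>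
           cmod (g i \<alpha>) \<le> gbound d n k \<alpha> (Lmax n d Hc) * (C * exp (- c * real k))))"
proof -
  have d: "d \<ge> 1" using assms by simp
  obtain C c where C: "C > 0" "c > 0" and
    few: "\<And>k. real (card {T \<in> catalan d k. left_comb d p \<notin> subtrees T})
           \<le> C * exp (- c * real k) * real (card (catalan d k))"
    using card_catalan_avoiding_exp_le[OF assms dcat_left_comb[OF d]] by blast
  have "cmod (g i \<alpha>) \<le> gbound d n k \<alpha> (Lmax n d Hc) * (C * exp (- c * real k))"
    if k: "k \<ge> 1" and g: "is_inverse n d Hc g" "JH_nilp n d Hc p" and i: "i < n"
      and \<alpha>: "\<alpha> \<in> mi n" "mdeg n \<alpha> = (d - 1) * k + 1" for k n Hc g i \<alpha>
  proof -
    let ?\<phi> = "indicator {T \<in> catalan d k. left_comb d p \<in> subtrees T} :: ptree \<Rightarrow> real"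
    have "cmod (g i \<alpha>) \<le> gbound d n k \<alpha> (Lmax n d Hc) * norm1 d k (\<lambda>T. ?\<phi> T - 1)"
      using norm_inverse_nilpotent_le[OF assms g i k \<alpha>] indicator_left_comb_mem_shuffle_span[OF d] .
    also have "\<dots> \<le> gbound d n k \<alpha> (Lmax n d Hc) * (C * exp (- c * real k))"
    proof (rule mult_left_mono)
      show "norm1 d k (\<lambda>T. ?\<phi> T - 1) \<le> C * exp (- c * real k)"
        using few[of k] card_catalan_pos[OF d, of k]
        by (simp add: norm1_indicator_minus_one divide_le_eq)
      show "gbound d n k \<alpha> (Lmax n d Hc) \<ge> 0"
        using norm_inverse_le[OF assms g(1) i k \<alpha>] norm_ge_zero order_trans by blast
    qed
    finally show ?thesis .
  qed
  then show ?thesis using C by (intro exI[of _ C] exI[of _ c] conjI exI[of _ 1]) auto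
qed

theorem theorem5p4:
  fixes d :: nat
  assumes "d \<ge> 2"
  shows
  \<comment> \<open>bound (1)\<close>
  "(\<forall>n\<ge>1. \<forall>Hc g. is_inverse n d Hc g \<longrightarrow>
      (\<forall>i<n. \<forall>k\<ge>1. \<forall>\<alpha>\<in>mi n. mdeg n \<alpha> = (d - 1) * k + 1 \<longrightarrow>
         cmod (g i \<alpha>) \<le> gbound d n k \<alpha> (Lmax n d Hc)))
   \<and>
   \<comment> \<open>sharpness\<close>
   (\<forall>n\<ge>1. \<exists>Hc g. is_inverse n d Hc g \<and> Lmax n d Hc > 0 \<and>
      (\<forall>i<n. \<forall>k\<ge>1. \<forall>\<alpha>\<in>mi n. mdeg n \<alpha> = (d - 1) * k + 1 \<longrightarrow>
         cmod (g i \<alpha>) = gbound d n k \<alpha> (Lmax n d Hc)))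
   \<and>
   \<comment> \<open>nilpotent case, shuffle-class refinement\<close>
   (\<forall>n\<ge>1. \<forall>Hc g p. is_inverse n d Hc g \<and> JH_nilp n d Hc p \<longrightarrow>
      (\<forall>i<n. \<forall>k\<ge>1. \<forall>\<alpha>\<in>mi n. mdeg n \<alpha> = (d - 1) * k + 1 \<longrightarrow>
         (\<forall>\<phi>\<in>shuffle_span d k p.
            cmod (g i \<alpha>) \<le> gbound d n k \<alpha> (Lmax n d Hc) * norm1 d k (\<lambda>T. \<phi> T - 1))))
   \<and>
   \<comment> \<open>exponential improvement, constants depending only on d and p\<close>
   (\<forall>p. \<exists>C c. C > 0 \<and> c > 0 \<and> (\<exists>K. \<forall>k\<ge>K.
      \<forall>n\<ge>1. \<forall>Hc g. is_inverse n d Hc g \<and> JH_nilp n d Hc p \<longrightarrow>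
        (\<forall>i<n. \<forall>\<alpha>\<in>mi n. mdeg n \<alpha> = (d - 1) * k + 1 \<longrightarrow>
           cmod (g i \<alpha>) \<le> gbound d n k \<alpha> (Lmax n d Hc) * (C * exp (- c * real k)))))"
  by (intro conjI allI impI ballI norm_inverse_nilpotent_exp_le[OF assms]
      ex_inverse_attaining_gbound[OF assms])
    (auto intro: norm_inverse_le[OF assms] norm_inverse_nilpotent_le[OF assms])

end
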